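(* Let $h\ge0$ be an integer, $H=h+1$, and let $z_1,\dots,z_h,z_{h+1}=a$ be nonnegative real numbers with $z_1+\cdots+z_h+a=1$. The stationary distribution of the annihilation model on $\mathrm{St}_h$ is given, for $B=b_1\cdots b_h\in\mathrm{St}_{h,k}$ (with $0\le k\le h$), by $$\Pi(B)=\prod_{\substack{i=1\\ b_i=\bullet}}^h\left(z_1+\cdots+z_{\psi_i(B)+1}\right)\ \prod_{j=1}^k\left(z_{j+1}+\cdots+z_h+a\right),$$ with $\psi_i(B)=\#\{j: i<j\le h,\ b_j=\circ\}$. Similarly, the stationary distribution of the enriched annihilation model on $\mathcal{S}(H)$ is given, for $\sigma\in\mathcal{S}(H)$ with $K$ blocks, by $$\tilde\Pi(\sigma)=\prod_{(s,t)\text{ arch of }\sigma} z_{C_\sigma(s,t)}\ \prod_{i=1}^{K-1}\left(z_{i+1}+\cdots+z_{H-1}+a\right).$$ There is no normalization factor: $\Pi$ and $\tilde\Pi$ are already normalized (each sums to $1$). (Here $z_{j+1}+\cdots+z_h+a$ means $\sum_{m=j+1}^{h+1}z_m$.)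
   Context: $\mathrm{St}_h$ is the set of words of length $h$ on $\{\bullet,\circ\}$ and $\mathrm{St}_{h,k}$ the subset of words with exactly $k$ occurrences of $\circ$. $\mathcal{S}(n)$ is the set of all set partitions of $\{1,\dots,n\}$. For a word $A$ and an integer $i\ge0$, $S_i(A)$ is obtained by replacing by $\bullet$ the $i$-th occurrence of $\circ$ in $A$ when $A$ is read from the right; if $i=0$ or $i$ exceeds the number of $\circ$'s in $A$, then $S_i(A)=A$. For $\sigma\in\mathcal{S}(H)$, $\sigma^\downarrow\in\mathcal{S}(h)$ is obtained by removing $1$ from its block (and removing this block if it becomes empty), and shifting all remaining elements down by $1$. For $\tau\in\mathcal{S}(n)$ and an integer $i\ge0$, $J_i(\tau)\in\mathcal{S}(n+1)$ is obtained by inserting $n+1$ into the $i$-th block of $\tau$, the blocks being numbered by decreasing order of their maxima; if $i=0$ or $i$ exceeds the number of blocks of $\tau$, then $J_i(\tau)=\tau\cup\{\{n+1\}\}$. An arch of $\sigma$ is a pair $(s,t)$ with $1\le s<t\le H$ such that $s,t$ belong to the same block of $\sigma$ and no integer strictly between $s$ and $t$ belongs to that block. $C_\sigma(s,t)$ is the number of blocks of $\sigma$ containing at least one element of $\{s,s+1,\dots,t\}$. The annihilation model is the Markov chain on $\mathrm{St}_h$ whose transition probability from $A=a_1\cdots a_h$ to $B$ is $$P_{A,B}=\begin{cases}z_i&\text{if }B=S_i(a_2\cdots a_h\circ)\text{ for some }i\in\{1,\dots,k\},\\ z_{k+1}+\cdots+z_h+a&\text{if }B=a_2\cdots a_h\circ,\\0&\text{otherwise,}\end{cases}$$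 with $k$ the number of $\circ$'s in $a_2\cdots a_h\circ$ (for $h=0$ the only state is the empty word and the chain stays there). The enriched annihilation model is the Markov chain on $\mathcal{S}(H)$ whose transition probability from $\sigma$ to $\tau$ is $$\tilde P_{\sigma,\tau}=\begin{cases}z_i&\text{if }\tau=J_i(\sigma^\downarrow)\text{ for some }i\in\{1,\dots,k\},\\ z_{k+1}+\cdots+z_h+a&\text{if }\tau=\sigma^\downarrow\cup\{\{H\}\},\\0&\text{otherwise,}\end{cases}$$ with $k$ the number of blocks of $\sigma^\downarrow$. *)

theory Defs
  imports Complex_Main "HOL-Library.Disjoint_Sets"
begin

section \<open>Stationary distributions on a finite state space\<close>

definition stationary_distribution :: "'s set \<Rightarrow> ('s \<Rightarrow> 's \<Rightarrow> real) \<Rightarrow> ('s \<Rightarrow> real) \<Rightarrow> bool" where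
  "stationary_distribution X P p \<longleftrightarrow>
     (\<forall>x\<in>X. 0 \<le> p x) \<and> (\<Sum>x\<in>X. p x) = 1 \<and> (\<forall>y\<in>X. (\<Sum>x\<in>X. p x * P x y) = p y)"

text \<open>Throughout, the parameters are a function \<open>z\<close> of which only the values
  \<open>z 1, \<dots>, z (h + 1)\<close> matter, with \<open>z (h + 1) = a\<close>; thus \<open>z\<^sub>k\<^sub>+\<^sub>1 + \<dots> + z\<^sub>h + a\<close> is
  \<open>\<Sum>m=k+1..h+1. z m\<close>.\<close>


section \<open>The annihilation model\<close>

datatype letter = Bullet | Circ

definition St :: "nat \<Rightarrow> letter list set" where
  "St h = {w. length w = h}"

definition num_circ :: "letter list \<Rightarrow> nat" where
  "num_circ w = count_list w Circ"

text \<open>A letter \<open>\<circ>\<close> is the \<open>i\<close>-th one from the right iff exactly \<open>i\<close> letters \<open>\<circ>\<close> are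
  weakly to its right. This never happens if \<open>i = 0\<close> or \<open>i > num_circ w\<close>.\<close>

definition S_op :: "nat \<Rightarrow> letter list \<Rightarrow> letter list" where
  "S_op i w =
     map (\<lambda>p. if w ! p = Circ \<and> card {q. p \<le> q \<and> q < length w \<and> w ! q = Circ} = i
              then Bullet else w ! p) [0..<length w]"

text \<open>The words \<open>S_op i w\<close> with \<open>1 \<le> i \<le> num_circ w\<close> are pairwise distinct, so the index
  picked by the definite description is unique.\<close>

definition annihilation_P :: "nat \<Rightarrow> (nat \<Rightarrow> real) \<Rightarrow> letter list \<Rightarrow> letter list \<Rightarrow> real" where
  "annihilation_P h z A B =
     (if h = 0 then of_bool (B = A)
      else let w = tl A @ [Circ]; k = num_circ w in
        if \<exists>i\<in>{1..k}. B = S_op i w then z (THE i. i \<in> {1..k} \<and> B = S_op i w)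
        else if B = w then \<Sum>m=k+1..h+1. z m
        else 0)"

text \<open>Letters are numbered from \<open>1\<close>: the letter \<open>b\<^sub>i\<close> of \<open>B\<close> is \<open>B ! (i - 1)\<close>.\<close>

definition psi :: "letter list \<Rightarrow> nat \<Rightarrow> nat" where
  "psi B i = card {j. i < j \<and> j \<le> length B \<and> B ! (j - 1) = Circ}"

definition annihilation_Pi :: "nat \<Rightarrow> (nat \<Rightarrow> real) \<Rightarrow> letter list \<Rightarrow> real" where
  "annihilation_Pi h z B =
     (\<Prod>i\<in>{i\<in>{1..h}. B ! (i - 1) = Bullet}. \<Sum>m=1..psi B i + 1. z m) *
     (\<Prod>j=1..num_circ B. \<Sum>m=j+1..h+1. z m)"


section \<open>The enriched annihilation model\<close>

definition set_partitions :: "nat \<Rightarrow> nat set set set" where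
  "set_partitions n = {\<sigma>. partition_on {1..n} \<sigma>}"

definition down :: "nat set set \<Rightarrow> nat set set" where
  "down \<sigma> = (\<lambda>b. (\<lambda>x. x - 1) ` (b - {1})) ` \<sigma> - {{}}"

text \<open>The \<open>i\<close>-th block by decreasing order of maxima, for \<open>1 \<le> i \<le> card \<tau>\<close>.\<close>

definition nth_block :: "nat set set \<Rightarrow> nat \<Rightarrow> nat set" where
  "nth_block \<tau> i = (THE b. b \<in> \<tau> \<and> card {c\<in>\<tau>. Max b \<le> Max c} = i)"

definition J_op :: "nat \<Rightarrow> nat \<Rightarrow> nat set set \<Rightarrow> nat set set" where
  "J_op n i \<tau> =
     (if i = 0 \<or> card \<tau> < i then \<tau> \<union> {{n + 1}}
      else (\<tau> - {nth_block \<tau> i}) \<union> {nth_block \<tau> i \<union> {n + 1}})"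

text \<open>As above, the index \<open>i\<close> is unique. The partitions have ground set \<open>{1..h + 1}\<close>.\<close>

definition enriched_P :: "nat \<Rightarrow> (nat \<Rightarrow> real) \<Rightarrow> nat set set \<Rightarrow> nat set set \<Rightarrow> real" where
  "enriched_P h z \<sigma> \<tau> =
     (let k = card (down \<sigma>) in
        if \<exists>i\<in>{1..k}. \<tau> = J_op h i (down \<sigma>)
        then z (THE i. i \<in> {1..k} \<and> \<tau> = J_op h i (down \<sigma>))
        else if \<tau> = down \<sigma> \<union> {{h + 1}} then \<Sum>m=k+1..h+1. z m
        else 0)"

definition arches :: "nat \<Rightarrow> nat set set \<Rightarrow> (nat \<times> nat) set" where
  "arches H \<sigma> =
     {(s, t). 1 \<le> s \<and> s < t \<and> t \<le> H \<and> (\<exists>b\<in>\<sigma>. s \<in> b \<and> t \<in> b \<and> b \<inter> {s<..<t} = {})}"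

definition C_arch :: "nat set set \<Rightarrow> nat \<Rightarrow> nat \<Rightarrow> nat" where
  "C_arch \<sigma> s t = card {b\<in>\<sigma>. b \<inter> {s..t} \<noteq> {}}"

definition enriched_Pi :: "nat \<Rightarrow> (nat \<Rightarrow> real) \<Rightarrow> nat set set \<Rightarrow> real" where
  "enriched_Pi h z \<sigma> =
     (\<Prod>(s, t)\<in>arches (h + 1) \<sigma>. z (C_arch \<sigma> s t)) *
     (\<Prod>i=1..card \<sigma> - 1. \<Sum>m=i+1..h+1. z m)"

end

theory Submission
  imports Defs
begin

text \<open>
  Read a state from the right and record, for each position, whether it starts a new block
  (\<open>None\<close>, the letter \<open>\<circ>\<close>) or is attached to an earlier one (\<open>Some x\<close>). With \<open>k\<close> heads to its
  right, a position is \<open>None\<close> with weight \<open>1 - (z 1 + \<dots> + z k)\<close>, and \<open>Some x\<close> with the total weight of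
  those \<open>m \<le> k\<close> that have the label \<open>x = f m\<close>. Constant labels give the annihilation model, and \<open>f = id\<close>
  the enriched one, \<open>Some j\<close> meaning the \<open>j\<close>-th block to the right by increasing minima, so that \<open>j\<close>
  is the number of blocks met by the arch.

  A step drops the first letter, turns the \<open>i\<close>-th head from the right, if there is one, into
  \<open>Some (f i)\<close>, and appends a head. The product weight is the law of a sequence grown from right to
  left, so dropping the first letter turns the weight for length \<open>n + 1\<close> into that for length \<open>n\<close>;
  an induction on the first letter shows that inserting with a random index restores it.

  Uniqueness, even if some \<open>z i\<close> vanish: the last \<open>m + 1\<close> letters after a step only depend
  on the last \<open>m\<close> letters before it and on the index, so a stationary law is determined by its
  trivial marginal at \<open>m = 0\<close>.
\<close>

section \<open>Stationary distributions\<close>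

text \<open>Agreement is asked on \<open>X\<close> only, since
  \<open>stationary_distribution\<close> does not constrain values elsewhere. Existence and
  uniqueness are bundled so that both can be transported at once.\<close>

definition unique_stationary :: "'s set \<Rightarrow> ('s \<Rightarrow> 's \<Rightarrow> real) \<Rightarrow> ('s \<Rightarrow> real) \<Rightarrow> bool" where
  "unique_stationary X P p \<longleftrightarrow> stationary_distribution X P p \<and>
     (\<forall>q. stationary_distribution X P q \<longrightarrow> (\<forall>x\<in>X. q x = p x))"

text \<open>Relabelling of states. Both directions serve below: existence is pulled back along
  \<open>e\<close>, and for uniqueness a competing law is pushed forward.\<close>

lemma stationary_distribution_transport:
  assumes e: "bij_betw e X Y"
    and P: "\<And>x y. x \<in> X \<Longrightarrow> y \<in> X \<Longrightarrow> P x y = Q (e x) (e y)"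
    and p: "\<And>x. x \<in> X \<Longrightarrow> p x = q (e x)"
  shows "stationary_distribution X P p \<longleftrightarrow> stationary_distribution Y Q q"
proof -
  have ball: "(\<forall>y\<in>Y. R y) \<longleftrightarrow> (\<forall>x\<in>X. R (e x))" for R
    using e by (auto simp: bij_betw_def)
  have sum: "sum g Y = (\<Sum>x\<in>X. g (e x))" for g :: "_ \<Rightarrow> real"
    by (rule sum.reindex_bij_betw[OF e, symmetric])
  show ?thesis
    unfolding stationary_distribution_def sum ball by (simp add: P p cong: sum.cong)
qed

lemma unique_stationary_transport:
  assumes e: "bij_betw e X Y"
    and P: "\<And>x y. x \<in> X \<Longrightarrow> y \<in> X \<Longrightarrow> P x y = Q (e x) (e y)"
    and p: "\<And>x. x \<in> X \<Longrightarrow> p x = q (e x)"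
    and "unique_stationary Y Q q"
  shows "unique_stationary X P p"
  unfolding unique_stationary_def
proof (intro conjI allI impI ballI)
  show "stationary_distribution X P p"
    using assms(4) stationary_distribution_transport[of e X Y P Q p q, OF e P p]
    by (simp add: unique_stationary_def)
next
  fix r x assume r: "stationary_distribution X P r" and x: "x \<in> X"
  \<comment> \<open>The competing law \<open>r\<close> is carried to \<open>Y\<close> by the inverse
    of \<open>e\<close>.\<close>
  have re: "r x = (r \<circ> inv_into X e) (e x)" if "x \<in> X" for x
    using that e by (simp add: bij_betw_inv_into_left)
  have "stationary_distribution Y Q (r \<circ> inv_into X e)"
    using r stationary_distribution_transport[of e X Y P Q r, OF e P re] by blast
  then have "(r \<circ> inv_into X e) (e x) = q (e x)"
    using assms(4) e x by (auto simp: unique_stationary_def bij_betw_def)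
  then show "r x = p x" using re p x by simp
qed

section \<open>Kernels driven by a random index\<close>

lemma sum_up_to_split:
  fixes g :: "nat \<Rightarrow> real"
  assumes "k \<le> N"
  shows "(\<Sum>i=1..N. g i) = (\<Sum>i=1..k. g i) + (\<Sum>i=k+1..N. g i)"
  using assms sum.ub_add_nat[of 1 k g "N - k"] by simp

text \<open>The case distinction is the law of \<open>s i\<close> for a random index
  \<open>i\<close> of weight \<open>z i\<close>. Injectivity up to \<open>k\<close> makes the
  described index unique, and all later indices lead to \<open>r\<close>, where their weights
  pool.\<close>

lemma indexed_kernel_eq_sum:
  fixes z :: "nat \<Rightarrow> real"
  assumes inj: "inj_on s {1..k}" and ne: "\<And>i. i \<in> {1..k} \<Longrightarrow> s i \<noteq> r"
    and gt: "\<And>i. k < i \<Longrightarrow> s i = r" and "k \<le> N"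
  shows "(if \<exists>i\<in>{1..k}. y = s i then z (THE i. i \<in> {1..k} \<and> y = s i)
          else if y = r then \<Sum>m=k+1..N. z m else 0)
         = (\<Sum>i=1..N. z i * of_bool (s i = y))"
proof -
  have split: "(\<Sum>i=1..N. z i * of_bool (s i = y))
      = (\<Sum>i=1..k. z i * of_bool (s i = y)) + (\<Sum>i=k+1..N. z i * of_bool (s i = y))"
    using \<open>k \<le> N\<close> by (rule sum_up_to_split)
  have tail: "(\<Sum>i=k+1..N. z i * of_bool (s i = y)) = of_bool (y = r) * (\<Sum>i=k+1..N. z i)"
    unfolding sum_distrib_left by (rule sum.cong) (auto simp: gt)
  show ?thesis
  proof (cases "\<exists>i\<in>{1..k}. y = s i")
    case True
    then obtain i where i: "i \<in> {1..k}" "y = s i" by blast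
    have uniq: "s j = s i \<longleftrightarrow> j = i" if "j \<in> {1..k}" for j
      using inj i that by (auto dest: inj_onD)
    have "(THE j. j \<in> {1..k} \<and> y = s j) = i"
      using i by (intro the_equality) (auto simp: uniq)
    moreover have "(\<Sum>j=1..k. z j * of_bool (s j = y)) = (\<Sum>j=1..k. if j = i then z j else 0)"
      using i by (intro sum.cong) (auto simp: uniq)
    then have "(\<Sum>j=1..k. z j * of_bool (s j = y)) = z i" using i by simp
    ultimately show ?thesis using True i ne unfolding split tail by auto
  next
    case False
    then have "(\<Sum>j=1..k. z j * of_bool (s j = y)) = 0" by (intro sum.neutral) auto
    then show ?thesis using False unfolding split tail by auto
  qed
qed

section \<open>Codes with weights\<close>

abbreviation heads :: "'x option list \<Rightarrow> nat" where
  "heads w \<equiv> count_list w None"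

text \<open>A head with \<open>heads w\<close> heads behind it is number \<open>heads w + 1\<close>
  from the right. The count refers to the tail before the change, so at most one head is
  hit.\<close>

fun ins :: "(nat \<Rightarrow> 'x) \<Rightarrow> nat \<Rightarrow> 'x option list \<Rightarrow> 'x option list" where
  "ins f i [] = [None]"
| "ins f i (c # w) = (if c = None \<and> i = heads w + 1 then Some (f i) else c) # ins f i w"

text \<open>For \<open>k = 0\<close> only \<open>None\<close> is left, so every nonempty code ends
  with a head.\<close>

definition letters :: "(nat \<Rightarrow> 'x) \<Rightarrow> nat \<Rightarrow> 'x option set" where
  "letters f k = insert None (Some ` f ` {1..k})"

fun codes :: "(nat \<Rightarrow> 'x) \<Rightarrow> nat \<Rightarrow> 'x option list set" where
  "codes f 0 = {[]}"
| "codes f (Suc n) = (\<lambda>(w, c). c # w) ` (SIGMA w:codes f n. letters f (heads w))"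

text \<open>Writing the weight of a head as a complement keeps it free of the largest index
  \<open>N\<close>, and makes the letter weights sum to 1 for any \<open>z\<close>.\<close>

fun letter_wt :: "(nat \<Rightarrow> 'x) \<Rightarrow> (nat \<Rightarrow> real) \<Rightarrow> nat \<Rightarrow> 'x option \<Rightarrow> real" where
  "letter_wt f z k None = 1 - (\<Sum>m=1..k. z m)"
| "letter_wt f z k (Some x) = (\<Sum>m | m \<in> {1..k} \<and> f m = x. z m)"

fun code_wt :: "(nat \<Rightarrow> 'x) \<Rightarrow> (nat \<Rightarrow> real) \<Rightarrow> 'x option list \<Rightarrow> real" where
  "code_wt f z [] = 1"
| "code_wt f z (c # w) = letter_wt f z (heads w) c * code_wt f z w"

section \<open>Effect of an insertion on heads and suffixes\<close>

lemma length_ins [simp]: "length (ins f i w) = Suc (length w)"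
  by (induction w) auto

lemma ins_gt: "heads w < i \<Longrightarrow> ins f i w = w @ [None]"
  by (induction w) (auto split: if_splits)

text \<open>A hit trades one head for the appended one; a miss only gains the appended one.\<close>

lemma heads_ins: "heads (ins f i w) = (if i \<in> {1..heads w} then heads w else heads w + 1)"
  by (induction w) auto

text \<open>Distinct indices hit distinct heads: the first letter reveals whether the largest index
  was used, and the tail separates the others.\<close>

lemma inj_on_ins: "inj_on (\<lambda>i. ins f i w) {1..heads w}"
proof (induction w)
  case (Cons c w)
  show ?case
  proof (rule inj_onI)
    fix i j assume ij: "i \<in> {1..heads (c # w)}" "j \<in> {1..heads (c # w)}"
      and eq: "ins f i (c # w) = ins f j (c # w)"
    show "i = j"
    proof (cases "c = None \<and> (i = heads w + 1 \<or> j = heads w + 1)")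
      case True
      then show ?thesis using eq by (auto split: if_splits)
    next
      case False
      then have "i \<in> {1..heads w}" "j \<in> {1..heads w}" using ij by (auto split: if_splits)
      then show ?thesis using Cons.IH eq by (auto dest: inj_onD)
    qed
  qed
qed simp

text \<open>Whether a letter is hit depends only on the letters to its right, so insertion commutes
  with passing to a suffix. Uniqueness of the stationary law rests on this.\<close>

lemma drop_ins: "d \<le> length w \<Longrightarrow> drop d (ins f i w) = ins f i (drop d w)"
  by (induction w arbitrary: d) (auto simp: drop_Cons split: nat.splits)

section \<open>The finite set of codes\<close>

lemma finite_letters [simp]: "finite (letters f k)"
  by (simp add: letters_def)

lemma finite_codes [simp]: "finite (codes f n)"
  by (induction n) auto

lemma length_codes: "w \<in> codes f n \<Longrightarrow> length w = n"
  by (induction n arbitrary: w) auto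

lemma heads_codes_le: "w \<in> codes f n \<Longrightarrow> heads w \<le> n"
  by (metis count_le_length length_codes)

lemma Cons_in_codes: "c # w \<in> codes f (Suc n) \<longleftrightarrow> w \<in> codes f n \<and> c \<in> letters f (heads w)"
  by force

declare codes.simps(2) [simp del]

lemma codes_SucE:
  assumes "W \<in> codes f (Suc n)"
  obtains c w where "W = c # w" "w \<in> codes f n" "c \<in> letters f (heads w)"
  using assms by (auto simp: codes.simps(2))

lemma sum_codes_Suc:
  "(\<Sum>W\<in>codes f (Suc n). g W) = (\<Sum>w\<in>codes f n. \<Sum>c\<in>letters f (heads w). g (c # w))"
proof -
  have "(\<Sum>W\<in>codes f (Suc n). g W)
      = (\<Sum>(w, c)\<in>(SIGMA w:codes f n. letters f (heads w)). g (c # w))"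
    unfolding codes.simps by (subst sum.reindex) (auto simp: inj_on_def case_prod_unfold)
  then show ?thesis by (simp add: sum.Sigma)
qed

text \<open>The number of heads behind a letter never decreases, so old labels stay admissible. A
  head hit by \<open>i\<close> has \<open>i - 1\<close> heads behind it before the step and
  \<open>i\<close> after it, which admits the new label \<open>f i\<close>.\<close>

lemma ins_in_codes: "w \<in> codes f n \<Longrightarrow> 1 \<le> i \<Longrightarrow> ins f i w \<in> codes f (Suc n)"
proof (induction n arbitrary: w)
  case (Suc n)
  from Suc.prems obtain c v where w: "w = c # v" "v \<in> codes f n" "c \<in> letters f (heads v)"
    by (auto elim: codes_SucE)
  show ?case using Suc.IH[OF w(2)] Suc.prems(2) w(3)
    by (auto simp: w(1) Cons_in_codes heads_ins letters_def)
qed (simp add: Cons_in_codes letters_def)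

lemma drop_in_codes: "w \<in> codes f (d + n) \<Longrightarrow> drop d w \<in> codes f n"
  by (induction d arbitrary: w) (auto elim!: codes_SucE)

section \<open>Laws of a single letter\<close>

lemma letter_wt_eq_0: "c \<notin> letters f k \<Longrightarrow> letter_wt f z k c = 0"
  by (cases c) (auto simp: letters_def intro!: sum.neutral)

text \<open>One more head to the right moves the mass \<open>z (Suc k)\<close> from
  \<open>None\<close> to the label of the new index.\<close>

lemma letter_wt_Suc:
  "letter_wt f z (Suc k) c
     = letter_wt f z k c + z (Suc k) * (of_bool (c = Some (f (Suc k))) - of_bool (c = None))"
proof (cases c)
  case (Some x)
  have "{m. m \<in> {1..Suc k} \<and> f m = x}
      = (if f (Suc k) = x then insert (Suc k) else id) {m. m \<in> {1..k} \<and> f m = x}"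
    by (auto simp: le_Suc_eq)
  then show ?thesis by (auto simp: Some)
qed simp

text \<open>The label weights are the sums of \<open>z\<close> over the fibres of \<open>f\<close>;
  together they make up what the weight of \<open>None\<close> lacks from 1.\<close>

lemma sum_letter_wt: "(\<Sum>c\<in>letters f k. letter_wt f z k c) = 1"
proof -
  have "(\<Sum>x\<in>f ` {1..k}. \<Sum>m | m \<in> {1..k} \<and> f m = x. z m) = (\<Sum>m=1..k. z m)"
    by (rule sum.image_gen[symmetric]) simp
  then have "(\<Sum>c\<in>Some ` f ` {1..k}. letter_wt f z k c) = (\<Sum>m=1..k. z m)"
    by (subst sum.reindex) auto
  then show ?thesis by (subst letters_def, subst sum.insert) auto
qed

text \<open>Law of the first letter after a step with fixed index: for \<open>i = k + 1\<close> the
  whole mass of \<open>None\<close> moves to \<open>Some (f i)\<close>, otherwise nothing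
  moves.\<close>

lemma sum_letters_kill:
  "(\<Sum>c\<in>letters f k. letter_wt f z k c * of_bool ((if c = None \<and> i = k + 1 then Some (f i) else c) = c'))
     = letter_wt f z k c' + of_bool (i = k + 1) * letter_wt f z k None *
         (of_bool (c' = Some (f i)) - of_bool (c' = None))"
proof -
  have "(\<Sum>c\<in>letters f k. letter_wt f z k c * of_bool ((if c = None \<and> i = k + 1 then Some (f i) else c) = c'))
    = (\<Sum>c\<in>letters f k. (if c = c' then letter_wt f z k c else 0) + (if c = None then
         of_bool (i = k + 1) * letter_wt f z k None *
         (of_bool (c' = Some (f i)) - of_bool (c' = None)) else 0))"
    by (rule sum.cong) auto
  also have "\<dots> = letter_wt f z k c' + of_bool (i = k + 1) * letter_wt f z k None *
         (of_bool (c' = Some (f i)) - of_bool (c' = None))"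
    unfolding sum.distrib using letter_wt_eq_0[of c' f k z]
    by (simp add: letters_def)
  finally show ?thesis .
qed

section \<open>Invariance of the product weight\<close>

text \<open>Averaging over the first letter must turn the letter law for \<open>heads w\<close> into
  that for \<open>heads B\<close>. If the index hits \<open>w\<close>, both counts agree. If it
  misses, the count rises by one, and the change of law is supplied by the index
  \<open>heads w + 1\<close>, which hits the first letter when that is a head.\<close>

lemma code_step_Cons:
  assumes sum1: "(\<Sum>i=1..N. z i) = 1" and "heads w < N"
  shows "(\<Sum>c\<in>letters f (heads w). letter_wt f z (heads w) c *
            (\<Sum>i=1..N. z i * of_bool (ins f i (c # w) = c' # B)))
       = letter_wt f z (heads B) c' * (\<Sum>i=1..N. z i * of_bool (ins f i w = B))"
    (is "?L = ?R")
proof -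
  let ?k = "heads w"
  let ?d = "\<lambda>i. of_bool (c' = Some (f i)) - of_bool (c' = None) :: real"
  have "?L = (\<Sum>i=1..N. z i * of_bool (ins f i w = B) *
      (\<Sum>c\<in>letters f ?k. letter_wt f z ?k c * of_bool ((if c = None \<and> i = ?k + 1 then Some (f i) else c) = c')))"
    unfolding sum_distrib_left
    by (subst sum.swap, intro sum.cong refl) auto
  also have "\<dots> = (\<Sum>i=1..N. z i * of_bool (ins f i w = B) *
      (letter_wt f z ?k c' + of_bool (i = ?k + 1) * letter_wt f z ?k None * ?d i))"
    unfolding sum_letters_kill ..
  \<comment> \<open>The correction lives at \<open>i = heads w + 1\<close> alone. That index misses
    \<open>w\<close>, so \<open>ins f i w\<close> becomes \<open>w @ [None]\<close> there.\<close>
  also have "\<dots> = letter_wt f z ?k c' * (\<Sum>i=1..N. z i * of_bool (ins f i w = B)) +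
      (\<Sum>i=1..N. if i = ?k + 1 then z i * of_bool (w @ [None] = B) * letter_wt f z ?k None * ?d i else 0)"
    unfolding sum_distrib_left sum.distrib[symmetric]
    by (intro sum.cong refl) (auto simp: ins_gt algebra_simps)
  also have "\<dots> = letter_wt f z ?k c' * (\<Sum>i=1..N. z i * of_bool (ins f i w = B)) +
      z (?k + 1) * of_bool (w @ [None] = B) * letter_wt f z ?k None * ?d (?k + 1)"
    using \<open>heads w < N\<close> by simp
  also have "\<dots> = ?R"
  proof (cases "w @ [None] = B")
    case True
    then have hB: "heads B = Suc ?k" by auto
    \<comment> \<open>Only the misses add a head. Their total mass is the weight of a head, the same
      factor as in the correction term, so \<open>letter_wt_Suc\<close> closes the case.\<close>
    have "(\<Sum>i=1..N. z i * of_bool (ins f i w = B)) = (\<Sum>i=?k+1..N. z i)"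
    proof (rule sum.mono_neutral_cong_right)
      show "\<forall>i\<in>{1..N} - {?k+1..N}. z i * of_bool (ins f i w = B) = 0"
        using hB heads_ins[of f _ w] by (auto simp: not_less_eq_eq[symmetric])
    qed (auto simp: ins_gt True)
    also have "\<dots> = letter_wt f z ?k None"
      using sum_up_to_split[of ?k N z] sum1 \<open>heads w < N\<close> by simp
    finally have S: "(\<Sum>i=1..N. z i * of_bool (ins f i w = B)) = letter_wt f z ?k None" .
    show ?thesis unfolding hB letter_wt_Suc S using True by (simp add: algebra_simps)
  next
    case False
    \<comment> \<open>An index that contributes here is a hit, and a hit preserves the number of
      heads.\<close>
    have "z i * of_bool (ins f i w = B) * letter_wt f z ?k c'
        = z i * of_bool (ins f i w = B) * letter_wt f z (heads B) c'" if "i \<in> {1..N}" for i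
      using False ins_gt[of w i f] heads_ins[of f i w] that by (cases "?k < i") auto
    then have E: "letter_wt f z ?k c' * (\<Sum>i=1..N. z i * of_bool (ins f i w = B)) = ?R"
      unfolding sum_distrib_left by (intro sum.cong) (auto simp: mult.commute)
    show ?thesis using False unfolding E by simp
  qed
  finally show ?thesis .
qed

text \<open>Stated for all \<open>n < N\<close> with \<open>N\<close> fixed: both the induction and
  the suffix marginals use lengths shorter than that of a state, with the same law of the
  index.\<close>

lemma code_step:
  assumes "(\<Sum>i=1..N. z i) = 1" and "n < N" and "length B = Suc n"
  shows "(\<Sum>w\<in>codes f n. code_wt f z w * (\<Sum>i=1..N. z i * of_bool (ins f i w = B))) = code_wt f z B"
  using assms(2,3)
proof (induction n arbitrary: B)
  case 0
  then obtain c where "B = [c]" by (auto simp: length_Suc_conv)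
  then show ?case using assms(1)
    by (cases c) (auto simp: sum_distrib_right[symmetric])
next
  case (Suc n)
  then obtain c' B' where B: "B = c' # B'" "length B' = Suc n" by (auto simp: length_Suc_conv)
  have "(\<Sum>w\<in>codes f (Suc n). code_wt f z w * (\<Sum>i=1..N. z i * of_bool (ins f i w = B)))
      = (\<Sum>w\<in>codes f n. code_wt f z w * (\<Sum>c\<in>letters f (heads w). letter_wt f z (heads w) c *
            (\<Sum>i=1..N. z i * of_bool (ins f i (c # w) = c' # B'))))"
    unfolding sum_codes_Suc B sum_distrib_left[of "code_wt f z _" _ "letters _ _"]
    by (simp only: code_wt.simps mult_ac)
  also have "\<dots> = (\<Sum>w\<in>codes f n. code_wt f z w * (letter_wt f z (heads B') c' *
            (\<Sum>i=1..N. z i * of_bool (ins f i w = B'))))"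
    using Suc.prems(1) by (intro sum.cong refl arg_cong2[where f = "(*)"] code_step_Cons assms(1))
      (auto dest: heads_codes_le)
  also have "\<dots> = letter_wt f z (heads B') c' *
      (\<Sum>w\<in>codes f n. code_wt f z w * (\<Sum>i=1..N. z i * of_bool (ins f i w = B')))"
    unfolding sum_distrib_left[of "letter_wt f z (heads B') c'" _ "codes f n"] by (simp only: mult_ac)
  also have "\<dots> = code_wt f z B" using Suc.IH[of B'] Suc.prems B by simp
  finally show ?case .
qed

section \<open>Normalization and positivity\<close>

text \<open>Given the tail, the first letter has total mass 1 and sums out.\<close>

lemma sum_code_wt_tl:
  "(\<Sum>W\<in>codes f (Suc n). code_wt f z W * g (tl W)) = (\<Sum>w\<in>codes f n. code_wt f z w * g w)"
proof -
  have "(\<Sum>c\<in>letters f (heads w). code_wt f z (c # w) * g (tl (c # w)))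
      = (\<Sum>c\<in>letters f (heads w). letter_wt f z (heads w) c) * (code_wt f z w * g w)" for w
    unfolding sum_distrib_right by (simp add: mult_ac)
  then show ?thesis unfolding sum_codes_Suc by (simp add: sum_letter_wt)
qed

lemma sum_code_wt: "(\<Sum>w\<in>codes f n. code_wt f z w) = 1"
proof (induction n)
  case (Suc n)
  then show ?case using sum_code_wt_tl[of f z "\<lambda>_. 1" n] by simp
qed simp

lemma code_wt_nonneg:
  assumes "\<And>i. i \<in> {1..N} \<Longrightarrow> 0 \<le> z i" and "(\<Sum>i=1..N. z i) = 1"
  shows "w \<in> codes f n \<Longrightarrow> n \<le> N \<Longrightarrow> 0 \<le> code_wt f z w"
proof (induction n arbitrary: w)
  case (Suc n)
  from Suc.prems(1) obtain c v where w: "w = c # v" "v \<in> codes f n"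
    by (auto elim: codes_SucE)
  have k: "heads v \<le> N" using heads_codes_le[OF w(2)] Suc.prems(2) by simp
  have "(\<Sum>m=1..heads v. z m) \<le> (\<Sum>m=1..N. z m)"
    using k assms(1) by (intro sum_mono2) auto
  then have "0 \<le> letter_wt f z (heads v) c"
    using assms k by (cases c) (auto intro!: sum_nonneg)
  then show ?case using Suc w by simp
qed simp

section \<open>The chain on codes and its unique stationary law\<close>

definition code_P :: "(nat \<Rightarrow> 'x) \<Rightarrow> (nat \<Rightarrow> real) \<Rightarrow> nat \<Rightarrow> 'x option list \<Rightarrow> 'x option list \<Rightarrow> real" where
  "code_P f z N V W = (\<Sum>i=1..N. z i * of_bool (ins f i (tl V) = W))"

text \<open>By stationarity the law of the last \<open>m + 1\<close> letters is the image of the law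
  of the last \<open>m\<close> letters under a random insertion. By \<open>code_step\<close>, the
  product weights obey the same recursion.\<close>

lemma stationary_code_marginal:
  fixes z :: "nat \<Rightarrow> real"
  assumes sum1: "(\<Sum>i=1..N. z i) = 1"
    and p: "stationary_distribution (codes f N) (code_P f z N) p"
    and "m \<le> N" and "v \<in> codes f m"
  shows "(\<Sum>W | W \<in> codes f N \<and> drop (N - m) W = v. p W) = code_wt f z v"
  using assms(3,4)
proof (induction m arbitrary: v)
  case 0
  \<comment> \<open>The empty suffix is shared by all codes, so its marginal is the total mass
    1.\<close>
  have "{W. W \<in> codes f N \<and> drop (N - 0) W = []} = codes f N" by (auto dest: length_codes)
  then show ?case using 0 p by (simp add: stationary_distribution_def)
next
  case (Suc m)
  define d where "d = N - Suc m"
  have N: "N = Suc (d + m)" using Suc.prems(1) by (simp add: d_def)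
  let ?X = "codes f N"
  have "(\<Sum>W | W \<in> ?X \<and> drop d W = v. p W) = (\<Sum>W\<in>?X. of_bool (drop d W = v) * p W)"
    by (rule sum.mono_neutral_cong_left) auto
  also have "\<dots> = (\<Sum>W\<in>?X. of_bool (drop d W = v) * (\<Sum>V\<in>?X. p V * code_P f z N V W))"
    using p by (intro sum.cong) (auto simp: stationary_distribution_def)
  also have "\<dots> = (\<Sum>V\<in>?X. p V * (\<Sum>i=1..N. z i * (\<Sum>W\<in>?X. of_bool (drop d W = v \<and> ins f i (tl V) = W))))"
    unfolding code_P_def sum_distrib_left
    by (subst sum.swap, rule sum.cong[OF refl], subst sum.swap) (intro sum.cong refl, simp)
  \<comment> \<open>Since \<open>N - m = d + 1\<close>, dropping the first letter, inserting and
    dropping \<open>d\<close> letters is the same as inserting into the last \<open>m\<close>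
    letters.\<close>
  also have "\<dots> = (\<Sum>V\<in>?X. p V * (\<Sum>i=1..N. z i * of_bool (ins f i (drop (N - m) V) = v)))"
  proof (intro sum.cong refl arg_cong2[where f = "(*)"])
    fix V i assume V: "V \<in> ?X" and i: "i \<in> {1..N}"
    from V obtain c w where w: "V = c # w" "w \<in> codes f (d + m)" unfolding N
      by (auto elim: codes_SucE)
    have "ins f i w \<in> ?X" using w i by (auto simp: N intro: ins_in_codes)
    moreover have "drop d (ins f i w) = ins f i (drop (N - m) V)"
      using w length_codes[OF w(2)] by (simp add: drop_ins N Suc_diff_le)
    moreover have "(\<Sum>W\<in>?X. of_bool (drop d W = v \<and> ins f i (tl V) = W) :: real)
       = (\<Sum>W\<in>?X. if W = ins f i w then of_bool (drop d W = v) else 0)"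
      by (intro sum.cong) (auto simp: w)
    ultimately show "(\<Sum>W\<in>?X. of_bool (drop d W = v \<and> ins f i (tl V) = W) :: real)
        = of_bool (ins f i (drop (N - m) V) = v)" by simp
  qed
  also have "\<dots> = (\<Sum>u\<in>codes f m. \<Sum>V | V \<in> ?X \<and> drop (N - m) V = u.
        p V * (\<Sum>i=1..N. z i * of_bool (ins f i (drop (N - m) V) = v)))"
    using drop_in_codes[of _ f "N - m" m] Suc.prems(1) by (intro sum.group[symmetric]) auto
  also have "\<dots> = (\<Sum>u\<in>codes f m. (\<Sum>V | V \<in> ?X \<and> drop (N - m) V = u. p V) *
        (\<Sum>i=1..N. z i * of_bool (ins f i u = v)))"
    by (intro sum.cong refl) (simp add: sum_distrib_right)
  also have "\<dots> = (\<Sum>u\<in>codes f m. code_wt f z u * (\<Sum>i=1..N. z i * of_bool (ins f i u = v)))"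
    using Suc by (intro sum.cong refl) simp
  also have "\<dots> = code_wt f z v"
    using Suc.prems length_codes by (intro code_step sum1) auto
  finally show ?case by (simp add: d_def)
qed

theorem unique_stationary_codes:
  fixes z :: "nat \<Rightarrow> real"
  assumes nonneg: "\<And>i. i \<in> {1..N} \<Longrightarrow> 0 \<le> z i" and sum1: "(\<Sum>i=1..N. z i) = 1"
  shows "unique_stationary (codes f N) (code_P f z N) (code_wt f z)"
  unfolding unique_stationary_def
proof (intro conjI allI impI ballI)
  \<comment> \<open>An empty sum is not 1, so \<open>N\<close> is positive and a first letter
    exists.\<close>
  obtain n where N: "N = Suc n" using sum1 by (cases N) auto
  show "stationary_distribution (codes f N) (code_P f z N) (code_wt f z)"
    unfolding stationary_distribution_def
  proof (intro conjI ballI)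
    fix W assume "W \<in> codes f N"
    then show "0 \<le> code_wt f z W" using code_wt_nonneg[OF nonneg sum1] by blast
    from \<open>W \<in> codes f N\<close> have "length W = Suc n" using length_codes N by blast
    then have "(\<Sum>w\<in>codes f n. code_wt f z w * (\<Sum>i=1..N. z i * of_bool (ins f i w = W))) = code_wt f z W"
      using sum1 by (intro code_step) (auto simp: N)
    then show "(\<Sum>V\<in>codes f N. code_wt f z V * code_P f z N V W) = code_wt f z W"
      unfolding code_P_def
      using sum_code_wt_tl[of f z "\<lambda>w. \<Sum>i=1..N. z i * of_bool (ins f i w = W)" n] by (simp add: N)
  qed (rule sum_code_wt)
next
  fix p W assume p: "stationary_distribution (codes f N) (code_P f z N) p" and W: "W \<in> codes f N"
  \<comment> \<open>At full length each marginal is the mass of a single code.\<close>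
  have "{V. V \<in> codes f N \<and> drop (N - N) V = W} = {W}" using W by auto
  then show "p W = code_wt f z W"
    using stationary_code_marginal[OF sum1 p order.refl W] by simp
qed

section \<open>The annihilation model\<close>

fun mark :: "letter \<Rightarrow> letter option" where
  "mark Circ = None"
| "mark Bullet = Some Bullet"

text \<open>The extra final head makes up for the order of the steps: \<open>annihilation_P\<close> appends \<open>\<circ>\<close> before it
  annihilates, \<open>ins\<close> appends \<open>None\<close> afterwards.\<close>

abbreviation word_code :: "letter list \<Rightarrow> letter option list" where
  "word_code B \<equiv> map mark B @ [None]"

text \<open>A bullet does not remember which index created it, so all indices share one
  label.\<close>

definition blank :: "nat \<Rightarrow> letter" where
  "blank i = Bullet"

section \<open>Words as codes\<close>

lemma inj_mark: "inj mark"
proof (rule injI)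
  show "x = y" if "mark x = mark y" for x y using that by (cases x; cases y) auto
qed

lemma num_circ_simps [simp]:
  "num_circ [] = 0" "num_circ (c # w) = num_circ w + of_bool (c = Circ)"
  by (auto simp: num_circ_def)

lemma heads_map_mark [simp]: "heads (map mark w) = num_circ w"
proof (induction w)
  case (Cons c w) then show ?case by (cases c) auto
qed simp

lemma num_circ_le_length: "num_circ w \<le> length w"
  by (simp add: num_circ_def count_le_length)

lemma card_Circ_from: "card {q. q < length w \<and> w ! q = Circ} = num_circ w"
  by (simp add: num_circ_def count_list_eq_length_filter length_filter_conv_card eq_commute)

text \<open>The circles weakly to the right of a position depend only on the suffix there. This
  gives \<open>S_op\<close> the recursion of \<open>ins\<close>.\<close>

lemma S_op_Cons:
  "S_op i (c # w) = (if c = Circ \<and> i = num_circ w + 1 then Bullet else c) # S_op i w"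
proof (rule nth_equalityI)
  fix p assume "p < length (S_op i (c # w))"
  then have p: "p < Suc (length w)" by (simp add: S_op_def)
  show "S_op i (c # w) ! p = ((if c = Circ \<and> i = num_circ w + 1 then Bullet else c) # S_op i w) ! p"
  proof (cases p)
    case 0
    have "card {q. q < Suc (length w) \<and> (c # w) ! q = Circ} = num_circ (c # w)"
      using card_Circ_from[of "c # w"] by simp
    then show ?thesis by (auto simp: S_op_def 0 simp del: upt_Suc)
  next
    case (Suc r)
    have "{q. Suc r \<le> q \<and> q < Suc (length w) \<and> (c # w) ! q = Circ}
        = Suc ` {q. r \<le> q \<and> q < length w \<and> w ! q = Circ}"
      (is "?L = ?R")
    proof (rule set_eqI)
      show "q \<in> ?L \<longleftrightarrow> q \<in> ?R" for q by (cases q) auto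
    qed
    then have "card {q. Suc r \<le> q \<and> q < Suc (length w) \<and> (c # w) ! q = Circ}
        = card {q. r \<le> q \<and> q < length w \<and> w ! q = Circ}"
      by (simp add: card_image)
    then show ?thesis using p by (auto simp: S_op_def Suc simp del: upt_Suc)
  qed
qed (simp add: S_op_def)

lemma ins_map_mark: "ins blank i (map mark w) = word_code (S_op i w)"
proof (induction w)
  case Nil show ?case by (simp add: S_op_def)
next
  case (Cons c w) then show ?case by (cases c) (auto simp: S_op_Cons blank_def)
qed

lemma word_code_eq_iff: "word_code A = word_code B \<longleftrightarrow> A = B"
  using inj_mark by (simp add: inj_map_eq_map)

text \<open>A bullet needs some head to its right, hence \<open>Suc k\<close>. The final head of
  \<open>word_code\<close> always provides one, so every word is allowed.\<close>

lemma letters_blank: "letters blank (Suc k) = range mark"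
proof -
  have "c \<in> {Circ, Bullet}" for c by (cases c) simp_all
  then have "(UNIV :: letter set) = {Circ, Bullet}" by blast
  then have "range mark = mark ` {Circ, Bullet}" by (rule arg_cong)
  then have "range mark = {None, Some Bullet}" by simp
  moreover have "Some (blank 1) \<in> letters blank (Suc k)"
    unfolding letters_def by (intro insertI2 imageI) simp
  then have "letters blank (Suc k) = {None, Some Bullet}" by (auto simp: letters_def blank_def)
  ultimately show ?thesis by simp
qed

lemma letter_wt_blank: "letter_wt blank z k (Some Bullet) = (\<Sum>m=1..k. z m)"
proof -
  have "{m. m \<in> {1..k} \<and> blank m = Bullet} = {1..k}" by (auto simp: blank_def)
  then show ?thesis by (simp only: letter_wt.simps)
qed

lemma bij_betw_word_code: "bij_betw word_code (St h) (codes blank (Suc h))"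
  unfolding bij_betw_def
proof
  show "inj_on word_code (St h)" by (rule inj_onI) (simp only: word_code_eq_iff)
  show "word_code ` St h = codes blank (Suc h)"
  proof (induction h)
    case 0
    show ?case by (auto simp: St_def codes.simps(2) letters_def)
  next
    case (Suc h)
    show ?case
    proof (intro equalityI subsetI)
      fix W assume "W \<in> word_code ` St (Suc h)"
      then obtain D where D: "W = word_code D" "length D = Suc h" by (auto simp: St_def)
      then obtain c B where "D = c # B" and B: "B \<in> St h" by (cases D) (auto simp: St_def)
      then have W: "W = mark c # word_code B" using D by simp
      have "word_code B \<in> codes blank (Suc h)" using B Suc.IH by blast
      then show "W \<in> codes blank (Suc (Suc h))"
        unfolding W Cons_in_codes by (simp add: letters_blank)
    next
      fix W assume "W \<in> codes blank (Suc (Suc h))"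
      then obtain c w where W: "W = c # w" "w \<in> codes blank (Suc h)" "c \<in> letters blank (heads w)"
        by (rule codes_SucE)
      then obtain B where B: "w = word_code B" "B \<in> St h" using Suc.IH by blast
      moreover obtain b where "c = mark b" using W(3) by (auto simp: B letters_blank)
      ultimately have "W = word_code (b # B)" "b # B \<in> St (Suc h)" by (auto simp: W St_def)
      then show "W \<in> word_code ` St (Suc h)" by blast
    qed
  qed
qed

section \<open>Transition probabilities and product formula for words\<close>

lemma annihilation_P_eq_code_P:
  assumes sum1: "(\<Sum>i=1..h+1. z i) = 1" and A: "A \<in> St h" and B: "B \<in> St h"
  shows "annihilation_P h z A B = code_P blank z (h + 1) (word_code A) (word_code B)"
proof (cases h)
  case 0
  \<comment> \<open>The only index has weight 1 and maps the only code \<open>[None]\<close> to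
    itself.\<close>
  then show ?thesis using A B sum1 by (simp add: annihilation_P_def code_P_def St_def)
next
  case (Suc g)
  then have "A \<noteq> []" using A by (auto simp: St_def)
  define w where "w = tl A @ [Circ]"
  \<comment> \<open>The extra final head plays the part of the appended circle.\<close>
  have tl: "tl (word_code A) = map mark w" using \<open>A \<noteq> []\<close> by (cases A) (simp_all add: w_def)
  have S_op: "S_op i w = S_op j w \<longleftrightarrow> ins blank i (map mark w) = ins blank j (map mark w)" for i j
    unfolding ins_map_mark word_code_eq_iff ..
  have gt: "S_op i w = w" if "num_circ w < i" for i
    using ins_gt[of "map mark w" i blank] that unfolding ins_map_mark word_code_eq_iff by simp
  have ne: "S_op i w \<noteq> w" if "i \<in> {1..num_circ w}" for i
  proof
    \<comment> \<open>An unchanged word would mean one head more after the insertion, whereas a hit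
      keeps their number.\<close>
    assume "S_op i w = w"
    then have "heads (ins blank i (map mark w)) = num_circ w + 1" by (simp add: ins_map_mark)
    then show False using that by (simp add: heads_ins)
  qed
  have inj: "inj_on (\<lambda>i. S_op i w) {1..num_circ w}"
    using inj_on_ins[of blank "map mark w"] unfolding inj_on_def S_op heads_map_mark .
  have "num_circ w \<le> h + 1" using A \<open>A \<noteq> []\<close> num_circ_le_length[of w]
    by (simp add: w_def St_def)
  have "h \<noteq> 0" using Suc by simp
  then have "annihilation_P h z A B = (\<Sum>i=1..h+1. z i * of_bool (S_op i w = B))"
    unfolding annihilation_P_def Let_def w_def[symmetric]
    using indexed_kernel_eq_sum[OF inj ne gt \<open>num_circ w \<le> h + 1\<close>, of B z] by (simp only: if_False)
  then show ?thesis by (simp only: code_P_def tl ins_map_mark word_code_eq_iff)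
qed

lemma psi_Cons:
  "psi (c # B) (Suc 0) = num_circ B" "1 \<le> i \<Longrightarrow> psi (c # B) (Suc i) = psi B i"
proof -
  have shift: "{j. Suc i < j \<and> j \<le> length (c # B) \<and> (c # B) ! (j - 1) = Circ}
      = Suc ` {j. i < j \<and> j \<le> length B \<and> B ! (j - 1) = Circ}" (is "?L i = ?R i") for i
  proof (rule set_eqI)
    show "j \<in> ?L i \<longleftrightarrow> j \<in> ?R i" for j by (cases j) (auto simp: nth_Cons')
  qed
  show "psi (c # B) (Suc i) = psi B i" for i
    unfolding psi_def shift by (simp add: card_image)
  have "{j. 0 < j \<and> j \<le> length B \<and> B ! (j - 1) = Circ} = Suc ` {q. q < length B \<and> B ! q = Circ}"
    (is "?L = ?R")
  proof (rule set_eqI)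
    show "j \<in> ?L \<longleftrightarrow> j \<in> ?R" for j by (cases j) auto
  qed
  then have "psi B 0 = num_circ B" by (simp add: psi_def card_image card_Circ_from)
  then show "psi (c # B) (Suc 0) = num_circ B"
    unfolding psi_def shift by (simp add: card_image)
qed

text \<open>Because of the final head, a bullet of \<open>B\<close> sees \<open>psi B i + 1\<close>
  heads, and the circles from right to left see 1, 2, ... of them. The final head sees none and has
  weight 1.\<close>

lemma annihilation_Pi_eq_code_wt:
  assumes sum1: "(\<Sum>i=1..h+1. z i) = 1" and B: "B \<in> St h"
  shows "annihilation_Pi h z B = code_wt blank z (word_code B)"
proof -
  have "(\<Prod>i\<in>{i\<in>{1..length B}. B ! (i - 1) = Bullet}. \<Sum>m=1..psi B i + 1. z m) *
        (\<Prod>j=1..num_circ B. 1 - (\<Sum>m=1..j. z m)) = code_wt blank z (word_code B)"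
  proof (induction B)
    case (Cons c B)
    let ?I = "\<lambda>B. {i\<in>{1..length B}. B ! (i - 1) = Bullet}"
    let ?f = "\<lambda>B i. \<Sum>m=1..psi B i + 1. z m"
    have I: "?I (c # B) = (if c = Bullet then {Suc 0} else {}) \<union> Suc ` ?I B" (is "?L = ?R")
    proof (rule set_eqI)
      show "i \<in> ?L \<longleftrightarrow> i \<in> ?R" for i by (cases i) (auto simp: nth_Cons')
    qed
    have "prod (?f (c # B)) (Suc ` ?I B) = prod (?f B) (?I B)"
      by (subst prod.reindex) (auto simp: psi_Cons intro!: prod.cong)
    then have P: "prod (?f (c # B)) (?I (c # B))
        = (if c = Bullet then \<Sum>m=1..num_circ B + 1. z m else 1) * prod (?f B) (?I B)"
      unfolding I by (subst prod.union_disjoint) (auto simp: psi_Cons)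
    have W: "code_wt blank z (word_code (c # B))
        = letter_wt blank z (num_circ B + 1) (mark c) * code_wt blank z (word_code B)"
      by simp
    show ?case unfolding P W Cons.IH[symmetric]
      by (cases c) (simp_all add: letter_wt_blank del: letter_wt.simps(2))
  qed simp
  moreover have "1 - (\<Sum>m=1..j. z m) = (\<Sum>m=j+1..h+1. z m)" if "j \<in> {1..num_circ B}" for j
    using sum1 sum_up_to_split[of j "h + 1" z] that num_circ_le_length[of B] B by (simp add: St_def)
  ultimately show ?thesis using B unfolding annihilation_Pi_def by (simp add: St_def)
qed

theorem unique_stationary_annihilation:
  assumes "\<And>i. i \<in> {1..h+1} \<Longrightarrow> 0 \<le> z i" and "(\<Sum>i=1..h+1. z i) = 1"
  shows "unique_stationary (St h) (annihilation_P h z) (annihilation_Pi h z)"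
proof (rule unique_stationary_transport)
  show "bij_betw word_code (St h) (codes blank (h + 1))" using bij_betw_word_code by simp
  show "unique_stationary (codes blank (h + 1)) (code_P blank z (h + 1)) (code_wt blank z)"
    using assms by (rule unique_stationary_codes)
qed (rule annihilation_P_eq_code_P[OF assms(2)] annihilation_Pi_eq_code_wt[OF assms(2)], assumption+)+

section \<open>The enriched annihilation model\<close>

text \<open>One notion for both orders on blocks, by minima and by maxima. An index out of range
  yields \<open>{}\<close>, which later stands for opening a new block.\<close>

definition nth_by :: "('a set \<Rightarrow> int) \<Rightarrow> 'a set set \<Rightarrow> nat \<Rightarrow> 'a set" where
  "nth_by g \<tau> i = (if i \<in> {1..card \<tau>} then THE b. b \<in> \<tau> \<and> card {c\<in>\<tau>. g c \<le> g b} = i else {})"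

text \<open>The rank is strictly monotone in \<open>g\<close>, hence injective into
  \<open>{1..card A}\<close>, hence onto by counting.\<close>

lemma bij_betw_rank:
  fixes g :: "'a \<Rightarrow> 'b::linorder"
  assumes "finite A" and "inj_on g A"
  shows "bij_betw (\<lambda>b. card {c\<in>A. g c \<le> g b}) A {1..card A}"
proof -
  let ?r = "\<lambda>b. card {c\<in>A. g c \<le> g b}"
  have less: "?r b < ?r b'" if "b \<in> A" "b' \<in> A" "g b < g b'" for b b'
  proof (rule psubset_card_mono)
    show "{c\<in>A. g c \<le> g b} \<subset> {c\<in>A. g c \<le> g b'}" using that by force
  qed (use \<open>finite A\<close> in simp)
  have inj: "inj_on ?r A"
  proof (rule inj_onI)
    fix b b' assume b: "b \<in> A" "b' \<in> A" and eq: "?r b = ?r b'"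
    then have "g b = g b'" using less[of b b'] less[of b' b] by (cases "g b" "g b'" rule: linorder_cases) auto
    then show "b = b'" using b \<open>inj_on g A\<close> by (auto dest: inj_onD)
  qed
  have "?r ` A \<subseteq> {1..card A}"
  proof (intro image_subsetI)
    fix b assume b: "b \<in> A"
    have "?r b \<le> card A" using \<open>finite A\<close> by (intro card_mono) auto
    moreover have "{c\<in>A. g c \<le> g b} \<noteq> {}" using b by auto
    then have "?r b \<noteq> 0" using \<open>finite A\<close> by (simp add: card_eq_0_iff)
    ultimately show "?r b \<in> {1..card A}" by simp
  qed
  moreover have "card (?r ` A) = card {1..card A}" using inj by (simp add: card_image)
  ultimately have "?r ` A = {1..card A}" by (intro card_subset_eq) auto
  with inj show ?thesis by (simp add: bij_betw_def)
qed

context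
  fixes g :: "'a set \<Rightarrow> int" and \<tau> :: "'a set set"
  assumes fin: "finite \<tau>" and inj: "inj_on g \<tau>"
begin

lemma nth_by_eqI:
  assumes "b \<in> \<tau>" and "card {c\<in>\<tau>. g c \<le> g b} = i"
  shows "nth_by g \<tau> i = b"
proof -
  note bij = bij_betw_rank[OF fin inj]
  have "i \<in> {1..card \<tau>}" using bij_betwE[OF bij] assms by blast
  moreover have "(THE b. b \<in> \<tau> \<and> card {c\<in>\<tau>. g c \<le> g b} = i) = b"
    using assms bij_betw_imp_inj_on[OF bij] by (intro the_equality) (auto dest: inj_onD)
  ultimately show ?thesis by (simp add: nth_by_def)
qed

lemma nth_by_rank:
  assumes "i \<in> {1..card \<tau>}"
  shows "nth_by g \<tau> i \<in> \<tau>" and "card {c\<in>\<tau>. g c \<le> g (nth_by g \<tau> i)} = i"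
proof -
  have "i \<in> (\<lambda>b. card {c\<in>\<tau>. g c \<le> g b}) ` \<tau>"
    using bij_betw_imp_surj_on[OF bij_betw_rank[OF fin inj]] assms by simp
  then obtain b where b: "b \<in> \<tau>" "card {c\<in>\<tau>. g c \<le> g b} = i" by blast
  then show "nth_by g \<tau> i \<in> \<tau>" "card {c\<in>\<tau>. g c \<le> g (nth_by g \<tau> i)} = i"
    using nth_by_eqI[OF b] by simp_all
qed

lemma nth_by_cases: "nth_by g \<tau> i = {} \<or> nth_by g \<tau> i \<in> \<tau>"
  using nth_by_rank(1)[of i] by (cases "i \<in> {1..card \<tau>}") (simp_all add: nth_by_def)

lemma nth_by_eq_empty_iff: "{} \<notin> \<tau> \<Longrightarrow> nth_by g \<tau> i = {} \<longleftrightarrow> i \<notin> {1..card \<tau>}"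
  using nth_by_rank(1)[of i] by (cases "i \<in> {1..card \<tau>}") (auto simp: nth_by_def)

lemma ex_nth_by: "b = {} \<or> b \<in> \<tau> \<Longrightarrow> \<exists>i\<le>card \<tau>. nth_by g \<tau> i = b"
proof (elim disjE)
  assume "b \<in> \<tau>"
  then have "card {c\<in>\<tau>. g c \<le> g b} \<in> {1..card \<tau>}"
    using bij_betwE[OF bij_betw_rank[OF fin inj]] by blast
  then show ?thesis using nth_by_eqI[OF \<open>b \<in> \<tau>\<close> refl]
    by (intro exI[of _ "card {c\<in>\<tau>. g c \<le> g b}"]) simp
qed (auto simp: nth_by_def intro: exI[of _ 0])

text \<open>Up to \<open>card \<tau>\<close>, only the index 0 is out of range, so \<open>{}\<close>
  has a single index too.\<close>

lemma nth_by_inject: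
  assumes "{} \<notin> \<tau>" and "i \<le> card \<tau>" and "j \<le> card \<tau>" and "nth_by g \<tau> i = nth_by g \<tau> j"
  shows "i = j"
proof (cases "i = 0 \<or> j = 0")
  case True
  then show ?thesis using assms nth_by_eq_empty_iff[OF assms(1), of i] nth_by_eq_empty_iff[OF assms(1), of j]
    by auto
next
  case False
  then have "i \<in> {1..card \<tau>}" "j \<in> {1..card \<tau>}" using assms(2,3) by auto
  then show ?thesis using nth_by_rank(2) assms(4) by metis
qed

end

lemma nth_by_image:
  assumes fin: "finite \<tau>" and inj: "inj_on g \<tau>"
    and h: "inj h" "h {} = {}" and g': "\<And>b c. b \<in> \<tau> \<Longrightarrow> c \<in> \<tau> \<Longrightarrow> g' (h b) \<le> g' (h c) \<longleftrightarrow> g b \<le> g c"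
  shows "nth_by g' (h ` \<tau>) i = h (nth_by g \<tau> i)"
proof (cases "i \<in> {1..card \<tau>}")
  case True
  define b where "b = nth_by g \<tau> i"
  note b = nth_by_rank[OF fin inj True, folded b_def]
  have inj': "inj_on g' (h ` \<tau>)"
  proof (intro inj_onI)
    fix x y assume "x \<in> h ` \<tau>" "y \<in> h ` \<tau>" "g' x = g' y"
    then obtain u v where uv: "x = h u" "y = h v" "u \<in> \<tau>" "v \<in> \<tau>" "g' (h u) = g' (h v)" by auto
    then have "g u = g v" using g'[of u v] g'[of v u] by simp
    then show "x = y" using uv inj by (auto dest: inj_onD)
  qed
  have "{c \<in> h ` \<tau>. g' c \<le> g' (h b)} = h ` {c\<in>\<tau>. g c \<le> g b}" using g' b by auto
  then have "card {c \<in> h ` \<tau>. g' c \<le> g' (h b)} = i"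
    using b card_image[OF inj_on_subset[OF h(1) subset_UNIV]] by simp
  then have "nth_by g' (h ` \<tau>) i = h b"
    using b fin inj' by (intro nth_by_eqI) auto
  then show ?thesis by (simp add: b_def)
next
  case False
  moreover have "card (h ` \<tau>) = card \<tau>" using h(1) by (intro card_image inj_on_subset[OF h(1)]) simp
  ultimately show ?thesis using h by (auto simp: nth_by_def)
qed

section \<open>Adjoining an element to a partition\<close>

text \<open>For \<open>b = {}\<close>, the element \<open>x\<close> forms a new block.\<close>

definition adjoin :: "'a \<Rightarrow> 'a set \<Rightarrow> 'a set set \<Rightarrow> 'a set set" where
  "adjoin x b \<tau> = insert (insert x b) (\<tau> - {b})"

lemma adjoin_eq_image:
  assumes "{} \<notin> \<tau>" and "b = {} \<or> b \<in> \<tau>"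
  shows "adjoin x b \<tau> = (\<lambda>c. if c = b then insert x c else c) ` \<tau> \<union> (if b = {} then {{x}} else {})"
  using assms by (auto simp: adjoin_def)

lemma inj_on_adjoin: "x \<notin> \<Union>\<tau> \<Longrightarrow> inj_on (\<lambda>c. if c = b then insert x c else c) \<tau>"
  by (auto simp: inj_on_def)

lemma card_adjoin:
  assumes "finite \<tau>" and "{} \<notin> \<tau>" and "x \<notin> \<Union>\<tau>" and "b = {} \<or> b \<in> \<tau>"
  shows "card (adjoin x b \<tau>) = card \<tau> + of_bool (b = {})"
proof -
  have "insert x b \<notin> \<tau> - {b}" using assms(3) by auto
  then have "card (adjoin x b \<tau>) = Suc (card (\<tau> - {b}))" using assms(1) by (simp add: adjoin_def)
  also have "\<dots> = card \<tau> + of_bool (b = {})"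
  proof (cases "b = {}")
    case False
    then show ?thesis using assms card_Suc_Diff1[of \<tau> b] by simp
  qed (use assms in simp)
  finally show ?thesis .
qed

lemma partition_on_adjoin:
  assumes \<tau>: "partition_on A \<tau>" and x: "x \<notin> A" and b: "b = {} \<or> b \<in> \<tau>"
  shows "partition_on (insert x A) (adjoin x b \<tau>)"
proof (rule partition_onI)
  show "\<Union>(adjoin x b \<tau>) = insert x A"
    using partition_onD1[OF \<tau>] b by (auto simp: adjoin_def)
  show "{} \<notin> adjoin x b \<tau>" using partition_onD3[OF \<tau>] by (auto simp: adjoin_def)
  fix p q assume "p \<in> adjoin x b \<tau>" "q \<in> adjoin x b \<tau>" "p \<noteq> q"
  then show "disjnt p q"
    using partition_onD1[OF \<tau>] disjointD[OF partition_onD2[OF \<tau>]] x b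
    by (auto simp: adjoin_def disjnt_def)
qed

text \<open>The new element alters no key of an old block, and as a singleton it comes last. Old
  ranks therefore persist, and only a new singleton takes rank \<open>card \<tau> + 1\<close>. This
  fits the least element under the order by maxima and the largest one under the order by
  minima.\<close>

lemma nth_by_adjoin:
  assumes fin: "finite \<tau>" and inj: "inj_on g \<tau>" and ne: "{} \<notin> \<tau>" and x: "x \<notin> \<Union>\<tau>"
    and b: "b = {} \<or> b \<in> \<tau>"
    and g_eq: "\<And>c. c \<in> \<tau> \<Longrightarrow> g (insert x c) = g c" and g_less: "\<And>c. c \<in> \<tau> \<Longrightarrow> g c < g {x}"
  shows "nth_by g (adjoin x b \<tau>) i =
    (if nth_by g \<tau> i = b \<and> (b \<noteq> {} \<or> i = card \<tau> + 1)
     then insert x (nth_by g \<tau> i) else nth_by g \<tau> i)"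
proof -
  define E where "E = (\<lambda>c. if c = b then insert x c else c)"
  have adj: "adjoin x b \<tau> = E ` \<tau> \<union> (if b = {} then {{x}} else {})"
    unfolding E_def by (rule adjoin_eq_image[OF ne b])
  have injE: "inj_on E \<tau>" unfolding E_def by (rule inj_on_adjoin[OF x])
  have gE: "g (E c) = g c" if "c \<in> \<tau>" for c unfolding E_def using g_eq[OF that] by (cases "c = b") simp_all
  have fin': "finite (adjoin x b \<tau>)" using fin by (simp add: adjoin_def)
  have inj': "inj_on g (adjoin x b \<tau>)"
  proof -
    have "inj_on g (E ` \<tau>)"
    proof (rule inj_onI)
      fix p q assume "p \<in> E ` \<tau>" "q \<in> E ` \<tau>" and eq: "g p = g q"
      then obtain u v where uv: "p = E u" "q = E v" "u \<in> \<tau>" "v \<in> \<tau>" by blast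
      then have "g u = g v" using eq gE by metis
      then show "p = q" using uv inj by (metis inj_onD)
    qed
    moreover have "g {x} \<notin> g ` (E ` \<tau> - {{x}})"
    proof
      assume "g {x} \<in> g ` (E ` \<tau> - {{x}})"
      then obtain c where "c \<in> \<tau>" "g {x} = g (E c)" by blast
      then show False using gE g_less by (metis less_irrefl)
    qed
    ultimately show ?thesis unfolding adj by (cases "b = {}") simp_all
  qed
  note eqI = nth_by_eqI[OF fin' inj']
  have card': "card (adjoin x b \<tau>) = card \<tau> + of_bool (b = {})"
    by (rule card_adjoin[OF fin ne x b])
  show ?thesis
  proof (cases "i \<in> {1..card \<tau>}")
    case True
    define e where "e = nth_by g \<tau> i"
    note e = nth_by_rank[OF fin inj True, folded e_def]
    have "\<not> g {x} \<le> g (E e)" using gE[OF e(1)] g_less[OF e(1)] by simp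
    then have "{c \<in> adjoin x b \<tau>. g c \<le> g (E e)} = {c \<in> E ` \<tau>. g c \<le> g (E e)}"
      unfolding adj by auto
    also have "\<dots> = E ` {c\<in>\<tau>. g c \<le> g e}" using gE e(1) by auto
    finally have "card {c \<in> adjoin x b \<tau>. g c \<le> g (E e)} = card (E ` {c\<in>\<tau>. g c \<le> g e})"
      by (rule arg_cong)
    also have "\<dots> = i"
      using e(2) by (subst card_image[OF inj_on_subset[OF injE]]) auto
    finally have "nth_by g (adjoin x b \<tau>) i = E e" using e(1) by (intro eqI) (auto simp: adj)
    moreover have "e \<noteq> {}" using e ne by auto
    ultimately show ?thesis unfolding e_def[symmetric] using True by (auto simp: E_def)
  next
    case False
    then have empty: "nth_by g \<tau> i = {}" unfolding nth_by_def by (rule if_not_P)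
    show ?thesis
    proof (cases "b = {} \<and> i = card \<tau> + 1")
      case True
      have "{c \<in> adjoin x b \<tau>. g c \<le> g {x}} = adjoin x b \<tau>"
        unfolding adj using gE g_less True by (auto simp: less_imp_le)
      then have "nth_by g (adjoin x b \<tau>) i = {x}" using True card' by (intro eqI) (auto simp: adjoin_def)
      then show ?thesis using True empty by simp
    next
      case nFalse: False
      then have "nth_by g (adjoin x b \<tau>) i = {}"
        unfolding nth_by_def card' using False by (intro if_not_P) auto
      then show ?thesis using nFalse empty by auto
    qed
  qed
qed

text \<open>\<open>m\<close> says that \<open>x\<close> and \<open>y\<close> end in the same block.
  When \<open>b = d = {}\<close>, it chooses between one new block \<open>{x, y}\<close> and two
  singletons.\<close>

lemma adjoin_swap:
  assumes x: "x \<notin> \<Union>\<tau>" and y: "y \<notin> \<Union>\<tau>" and "x \<noteq> y" and "{} \<notin> \<tau>"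
    and b: "b = {} \<or> b \<in> \<tau>" and d: "d = {} \<or> d \<in> \<tau>"
    and m: "m \<Longrightarrow> b = d" "b = d \<Longrightarrow> b \<noteq> {} \<Longrightarrow> m"
  shows "adjoin y (if m then insert x d else d) (adjoin x b \<tau>)
       = adjoin x (if m then insert y b else b) (adjoin y d \<tau>)"
proof (cases m)
  case True
  have "insert x b \<notin> \<tau>" "insert y b \<notin> \<tau>" using x y by auto
  then show ?thesis using True m(1) by (auto simp: adjoin_def insert_commute)
next
  case False
  have "insert x b \<noteq> d" "insert y d \<noteq> b" using x y b d by auto
  then have "insert (insert x b) (\<tau> - {b}) - {d} = insert (insert x b) (\<tau> - {b} - {d})"
    "insert (insert y d) (\<tau> - {d}) - {b} = insert (insert y d) (\<tau> - {d} - {b})" by auto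
  then show ?thesis using False by (auto simp: adjoin_def)
qed

section \<open>Partitions of integer intervals\<close>

definition min_key :: "nat set \<Rightarrow> int" where
  "min_key b = int (Min b)"

text \<open>The sign turns decreasing maxima into increasing keys.\<close>

definition max_key :: "nat set \<Rightarrow> int" where
  "max_key b = - int (Max b)"

abbreviation shift :: "nat set set \<Rightarrow> nat set set" where
  "shift \<tau> \<equiv> (`) Suc ` \<tau>"

lemma partition_on_block:
  fixes l u :: nat
  assumes "partition_on {l..u} \<tau>" and "b \<in> \<tau>"
  shows "finite b" "b \<noteq> {}" "b \<subseteq> {l..u}"
proof -
  show "b \<subseteq> {l..u}" using assms partition_onD1 by blast
  then show "finite b" by (rule finite_subset) simp
  show "b \<noteq> {}" using assms partition_onD3 by blast
qed

text \<open>The minimum and the maximum lie in their block, and distinct blocks share no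
  element.\<close>

lemma inj_on_keys:
  fixes l u :: nat
  assumes \<tau>: "partition_on {l..u} \<tau>"
  shows "inj_on min_key \<tau>" and "inj_on max_key \<tau>"
proof -
  have eq: "b = c" if "b \<in> \<tau>" "c \<in> \<tau>" "x \<in> b" "x \<in> c" for b c x
    using disjointD[OF partition_onD2[OF \<tau>]] that by blast
  have Min: "Min b \<in> b" "Max b \<in> b" if "b \<in> \<tau>" for b
    using partition_on_block[OF \<tau> that] by auto
  show "inj_on min_key \<tau>" "inj_on max_key \<tau>"
    using Min eq by (auto simp: inj_on_def min_key_def max_key_def) metis+
qed

lemma Max_Suc_image: "finite b \<Longrightarrow> b \<noteq> {} \<Longrightarrow> Max (Suc ` b) = Suc (Max b)"
  using mono_Max_commute[of Suc b] by (simp add: mono_def)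

lemma partition_on_shift:
  assumes "partition_on {1..n} \<tau>"
  shows "partition_on {2..Suc n} (shift \<tau>)"
proof -
  have "partition_on (Suc ` {1..n}) (shift \<tau> - {{}})"
    using assms by (rule partition_on_inj_image) simp
  moreover have "{} \<notin> shift \<tau>" using partition_onD3[OF assms] by auto
  moreover have "Suc ` {1..n} = {2..Suc n}" by (simp add: numeral_2_eq_2)
  ultimately show ?thesis by (simp add: numeral_2_eq_2)
qed

lemma J_op_eq_adjoin:
  assumes "partition_on {1..n} \<tau>"
  shows "J_op n i \<tau> = adjoin (n + 1) (nth_by max_key \<tau> i) \<tau>"
proof (cases "i \<in> {1..card \<tau>}")
  case True
  then have "nth_by max_key \<tau> i = nth_block \<tau> i" by (simp add: nth_by_def nth_block_def max_key_def)
  then show ?thesis using True by (auto simp: J_op_def adjoin_def)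
next
  case False
  then have "nth_by max_key \<tau> i = {}" by (auto simp: nth_by_def)
  moreover have "i = 0 \<or> card \<tau> < i" using False by auto
  then have "J_op n i \<tau> = insert {n + 1} \<tau>" unfolding J_op_def by (simp only: if_True) simp
  moreover have "\<tau> - {{}} = \<tau>" using partition_onD3[OF assms] by simp
  ultimately show ?thesis by (simp add: adjoin_def)
qed

section \<open>Partitions from codes\<close>

text \<open>The index \<open>0\<close> of \<open>None\<close> selects the empty block in \<open>nth_by\<close>, hence a new block.\<close>

fun label :: "nat option \<Rightarrow> nat" where
  "label None = 0"
| "label (Some j) = j"

text \<open>Elements enter as 1 while the others move up, so that letters from first to last
  describe 1, 2, ... and \<open>down\<close> amounts to removing the first letter.\<close>

fun decode :: "nat option list \<Rightarrow> nat set set" where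
  "decode [] = {}"
| "decode (c # w) = adjoin 1 (Suc ` nth_by min_key (decode w) (label c)) (shift (decode w))"

lemma partition_on_decode: "partition_on {1..length w} (decode w)"
proof (induction w)
  case (Cons c w)
  have fin: "finite (decode w)" using finite_elements[OF _ Cons] by simp
  have "partition_on (insert 1 {2..Suc (length w)}) (decode (c # w))"
    unfolding decode.simps using nth_by_cases[OF fin inj_on_keys(1)[OF Cons]]
    by (intro partition_on_adjoin partition_on_shift Cons) auto
  moreover have "insert 1 {2..Suc (length w)} = {1..length (c # w)}" by auto
  ultimately show ?case by simp
qed (simp add: partition_on_empty)

lemma finite_decode: "finite (decode w)"
  using finite_elements[OF _ partition_on_decode] by simp

lemmas inj_on_min_key_decode = inj_on_keys(1)[OF partition_on_decode]
lemmas empty_notin_decode = partition_onD3[OF partition_on_decode]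

lemma shift_decode:
  "{} \<notin> shift (decode w)" "1 \<notin> \<Union>(shift (decode w))" "Suc (Suc (length w)) \<notin> \<Union>(shift (decode w))"
proof -
  note part = partition_on_shift[OF partition_on_decode[of w]]
  show "{} \<notin> shift (decode w)" by (rule partition_onD3[OF part])
  show "1 \<notin> \<Union>(shift (decode w))" "Suc (Suc (length w)) \<notin> \<Union>(shift (decode w))"
    unfolding partition_onD1[OF part, symmetric] by simp_all
qed

lemma min_block_cases:
  "Suc ` nth_by min_key (decode w) j = {} \<or> Suc ` nth_by min_key (decode w) j \<in> shift (decode w)"
  using nth_by_cases[OF finite_decode inj_on_min_key_decode] by auto

lemma inj_image_Suc: "inj ((`) Suc)"
  by (simp add: inj_on_image)

lemma card_shift: "card (shift \<tau>) = card \<tau>"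
  by (rule card_image) (rule inj_on_subset[OF inj_image_Suc subset_UNIV])

text \<open>In a code every label is at most the current number of blocks, so precisely the heads
  open new ones.\<close>

lemma card_decode: "w \<in> codes id n \<Longrightarrow> card (decode w) = heads w"
proof (induction n arbitrary: w)
  case (Suc n)
  from Suc.prems obtain c v where w: "w = c # v" "v \<in> codes id n" "c \<in> letters id (heads v)"
    by (rule codes_SucE)
  have "nth_by min_key (decode v) (label c) = {} \<longleftrightarrow> c = None"
    using nth_by_eq_empty_iff[OF finite_decode inj_on_min_key_decode empty_notin_decode, of v "label c"]
      w(3) Suc.IH[OF w(2)] by (auto simp: letters_def)
  then show ?case
    using card_adjoin[OF _ shift_decode(1,2) min_block_cases, of v "label c"] Suc.IH[OF w(2)]
    by (simp add: w(1) card_shift finite_decode)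
qed simp

lemma down_decode: "down (decode (c # w)) = decode w"
proof -
  let ?b = "nth_by min_key (decode w) (label c)"
  let ?f = "\<lambda>b. (\<lambda>x. x - 1) ` (b - {1::nat})"
  have pos: "0 \<notin> b" if "b \<in> decode w" for b
    using partition_on_block(3)[OF partition_on_decode that] by auto
  have f: "?f (Suc ` b) = b" "?f (insert 1 (Suc ` b)) = b" if "0 \<notin> b" for b
  proof -
    have "1 \<notin> Suc ` b" using that by auto
    then have "Suc ` b - {1} = Suc ` b" "insert 1 (Suc ` b) - {1} = Suc ` b" by auto
    moreover have "(\<lambda>x. x - 1) ` Suc ` b = b" by (simp add: image_image)
    ultimately show "?f (Suc ` b) = b" "?f (insert 1 (Suc ` b)) = b" by (simp_all only:)
  qed
  have b: "?b = {} \<or> ?b \<in> decode w"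
    by (rule nth_by_cases[OF finite_decode inj_on_min_key_decode])
  have diff: "shift (decode w) - {Suc ` ?b} = shift (decode w - {?b})"
    unfolding image_set_diff[OF inj_image_Suc] by simp
  have "(\<lambda>b. ?f (Suc ` b)) ` (decode w - {?b}) = (\<lambda>b. b) ` (decode w - {?b})"
  proof (rule image_cong[OF refl])
    fix b assume "b \<in> decode w - {?b}"
    then have "0 \<notin> b" using pos by blast
    then show "?f (Suc ` b) = b" by (rule f(1))
  qed
  then have "?f ` shift (decode w - {?b}) = decode w - {?b}"
    by (simp only: image_image image_ident)
  moreover have "?f (insert 1 (Suc ` ?b)) = ?b" using b pos by (intro f(2)) auto
  ultimately have "?f ` decode (c # w) = insert ?b (decode w - {?b})"
    by (simp only: decode.simps adjoin_def diff image_insert)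
  \<comment> \<open>If 1 was a singleton, \<open>?b\<close> is empty and is discarded here;
    otherwise \<open>?b\<close> returns to its place.\<close>
  then have "down (decode (c # w)) = insert ?b (decode w - {?b}) - {{}}"
    unfolding down_def by (simp only:)
  also have "\<dots> = decode w"
  proof (cases "?b = {}")
    case True
    then show ?thesis using empty_notin_decode[of w] by simp
  next
    case False
    then have "insert ?b (decode w - {?b}) = decode w" using b by blast
    then show ?thesis using empty_notin_decode[of w] by simp
  qed
  finally show ?thesis .
qed

section \<open>Insertion of the largest element\<close>

lemma nth_by_shift:
  assumes "partition_on {1..n} \<tau>"
  shows "nth_by max_key (shift \<tau>) i = Suc ` nth_by max_key \<tau> i"
proof (rule nth_by_image)
  show "finite \<tau>" using finite_elements[OF _ assms] by simp
  show "max_key (Suc ` b) \<le> max_key (Suc ` c) \<longleftrightarrow> max_key b \<le> max_key c" if "b \<in> \<tau>" "c \<in> \<tau>" for b c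
    using partition_on_block[OF assms that(1)] partition_on_block[OF assms that(2)]
    by (simp add: max_key_def Max_Suc_image)
qed (use inj_on_keys[OF assms] inj_image_Suc in auto)

text \<open>\<open>J_op\<close> counts blocks by maxima and so treats the block of \<open>1\<close> as if \<open>1\<close> were absent, unless
  that block is \<open>{1}\<close>, which comes last. Symmetrically, \<open>n + 1\<close> does not affect the order by minima.\<close>

lemma decode_ins:
  assumes "w \<in> codes id n" and "1 \<le> i"
  shows "decode (ins id i w) = J_op n i (decode w)"
  using assms(1)
proof (induction n arbitrary: w)
  case 0
  then show ?case using \<open>1 \<le> i\<close> by (simp add: J_op_def nth_by_def adjoin_def)
next
  case (Suc n)
  from Suc.prems obtain c v where w: "w = c # v" "v \<in> codes id n" "c \<in> letters id (heads v)"
    by (rule codes_SucE)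
  define \<tau> where "\<tau> = decode v"
  have n: "length v = n" using length_codes[OF w(2)] .
  have part: "partition_on {1..n} \<tau>" using partition_on_decode[of v] by (simp add: \<tau>_def n)
  note part' = partition_on_shift[OF part]
  have fin: "finite \<tau>" by (simp add: \<tau>_def finite_decode)
  have ne: "{} \<notin> \<tau>" by (simp add: \<tau>_def empty_notin_decode)
  have k: "card \<tau> = heads v" using card_decode[OF w(2)] by (simp add: \<tau>_def)
  define b where "b = nth_by min_key \<tau> (label c)"
  define d where "d = nth_by max_key \<tau> i"
  have b: "b = {} \<or> b \<in> \<tau>" unfolding b_def by (rule nth_by_cases[OF fin inj_on_keys(1)[OF part]])
  have d: "d = {} \<or> d \<in> \<tau>" unfolding d_def by (rule nth_by_cases[OF fin inj_on_keys(2)[OF part]])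
  have b_empty: "b = {} \<longleftrightarrow> c = None"
    unfolding b_def using nth_by_eq_empty_iff[OF fin inj_on_keys(1)[OF part] ne, of "label c"] w(3) k
    by (auto simp: letters_def)
  have d_empty: "d = {} \<longleftrightarrow> card \<tau> < i"
    unfolding d_def using nth_by_eq_empty_iff[OF fin inj_on_keys(2)[OF part] ne, of i] \<open>1 \<le> i\<close> by auto
  \<comment> \<open>\<open>m\<close> says that 1 and the new largest element share a block. The
    second alternative covers 1 being a singleton: its rank by maxima is
    \<open>card \<tau> + 1\<close>, the last one.\<close>
  define m where "m \<longleftrightarrow> b = d \<and> (b \<noteq> {} \<or> i = card \<tau> + 1)"
  define c' where "c' = (if c = None \<and> i = heads v + 1 then Some i else c)"

  have "nth_by max_key (adjoin 1 (Suc ` b) (shift \<tau>)) i =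
      (if nth_by max_key (shift \<tau>) i = Suc ` b \<and> (Suc ` b \<noteq> {} \<or> i = card (shift \<tau>) + 1)
       then insert 1 (nth_by max_key (shift \<tau>) i) else nth_by max_key (shift \<tau>) i)"
  proof (rule nth_by_adjoin)
    fix C assume C: "C \<in> shift \<tau>"
    note C' = partition_on_block[OF part' C]
    have "2 \<le> Max C" using subsetD[OF C'(3) Max_in] C' by simp
    then show "max_key (insert 1 C) = max_key C" "max_key C < max_key {1}"
      using C' by (simp_all add: max_key_def)
  qed (use fin inj_on_keys[OF part'] ne b shift_decode(2)[of v] in \<open>auto simp: \<tau>_def\<close>)
  also have "\<dots> = (if m then insert 1 (Suc ` d) else Suc ` d)"
    unfolding nth_by_shift[OF part] d_def[symmetric] card_shift m_def
    by (auto simp: inj_image_eq_iff)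
  finally have max: "nth_by max_key (adjoin 1 (Suc ` b) (shift \<tau>)) i = (if m then insert 1 (Suc ` d) else Suc ` d)" .

  have "n + 1 \<notin> \<Union>\<tau>" unfolding partition_onD1[OF part, symmetric] by simp
  then have "nth_by min_key (adjoin (n + 1) d \<tau>) (label c') =
      (if nth_by min_key \<tau> (label c') = d \<and> (d \<noteq> {} \<or> label c' = card \<tau> + 1)
       then insert (n + 1) (nth_by min_key \<tau> (label c')) else nth_by min_key \<tau> (label c'))"
  proof (intro nth_by_adjoin)
    fix C assume C: "C \<in> \<tau>"
    note C' = partition_on_block[OF part C]
    have "Min C \<le> n" using subsetD[OF C'(3) Min_in] C' by simp
    then show "min_key (insert (n + 1) C) = min_key C" "min_key C < min_key {n + 1}"
      using C' by (simp_all add: min_key_def)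
  qed (use fin inj_on_keys[OF part] ne d in auto)
  also have "\<dots> = (if m then insert (n + 1) b else b)"
  proof (cases "c = None \<and> i = heads v + 1")
    case True
    \<comment> \<open>The head has become \<open>Some i\<close> with
      \<open>i = card \<tau> + 1\<close>, a rank out of range in \<open>\<tau>\<close> that
      designates the newly adjoined \<open>{n + 1}\<close>.\<close>
    then have "nth_by min_key \<tau> (label c') = {}" by (simp add: c'_def nth_by_def k)
    then show ?thesis using True b_empty d_empty k by (simp add: m_def c'_def)
  next
    case False
    then have "c' = c" by (auto simp: c'_def)
    moreover have "label c \<noteq> card \<tau> + 1" using w(3) k by (auto simp: letters_def)
    ultimately have lab: "nth_by min_key \<tau> (label c') = b" "label c' \<noteq> card \<tau> + 1"
      by (simp_all add: b_def)
    have "\<not> (b = {} \<and> i = card \<tau> + 1)" using False b_empty k by simp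
    then have "b = d \<and> (d \<noteq> {} \<or> label c' = card \<tau> + 1) \<longleftrightarrow> m" unfolding m_def using lab(2) by metis
    then show ?thesis unfolding lab(1) by simp
  qed
  finally have min: "nth_by min_key (adjoin (n + 1) d \<tau>) (label c') = (if m then insert (n + 1) b else b)" .

  have diff: "shift (\<tau> - {d}) = shift \<tau> - {Suc ` d}"
    unfolding image_set_diff[OF inj_image_Suc] by simp
  have shift: "shift (adjoin (n + 1) d \<tau>) = adjoin (n + 2) (Suc ` d) (shift \<tau>)"
    by (simp add: adjoin_def diff)
  have "J_op (Suc n) i (decode w) = adjoin (n + 2) (if m then insert 1 (Suc ` d) else Suc ` d) (adjoin 1 (Suc ` b) (shift \<tau>))"
    using J_op_eq_adjoin[OF partition_on_decode[of w], of i] max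
    by (simp add: w(1) n \<tau>_def b_def)
  also have "\<dots> = adjoin 1 (if m then insert (n + 2) (Suc ` b) else Suc ` b) (adjoin (n + 2) (Suc ` d) (shift \<tau>))"
    using shift_decode[of v] b d by (intro adjoin_swap) (auto simp: \<tau>_def n m_def inj_image_eq_iff)
  also have "\<dots> = adjoin 1 (Suc ` (if m then insert (n + 1) b else b)) (shift (adjoin (n + 1) d \<tau>))"
    unfolding shift by simp
  also have "\<dots> = decode (c' # ins id i v)"
    unfolding decode.simps Suc.IH[OF w(2)] J_op_eq_adjoin[OF part, of i, folded d_def] min[symmetric] \<tau>_def[symmetric] ..
  also have "c' # ins id i v = ins id i w" by (simp add: w(1) c'_def)
  finally show ?case by (rule sym)
qed

section \<open>Bijectivity of decoding\<close>

text \<open>\<open>down\<close> recovers the tail of the code, and the block of 1 recovers the first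
  label.\<close>

lemma inj_on_decode: "inj_on decode (codes id n)"
proof (induction n)
  case (Suc n)
  show ?case
  proof (rule inj_onI)
    fix W W' assume "W \<in> codes id (Suc n)" "W' \<in> codes id (Suc n)" and eq: "decode W = decode W'"
    then obtain c w c' w' where W: "W = c # w" "w \<in> codes id n" "c \<in> letters id (heads w)"
      and W': "W' = c' # w'" "w' \<in> codes id n" "c' \<in> letters id (heads w')"
      by (metis codes_SucE)
    have "decode w = decode w'" using eq down_decode W(1) W'(1) by metis
    then have w': "w' = w" by (intro inj_onD[OF Suc.IH _ W'(2) W(2)]) simp
    let ?b = "\<lambda>c. nth_by min_key (decode w) (label c)"
    have one: "C = insert 1 (Suc ` ?b c)" if "C \<in> decode (c # w)" "1 \<in> C" for c C
      using that shift_decode(2)[of w] by (auto simp: adjoin_def)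
    have "insert 1 (Suc ` ?b c) \<in> decode (c # w)" by (simp add: adjoin_def)
    moreover have "decode (c # w) = decode (c' # w)" using eq by (simp only: W(1) W'(1) w')
    ultimately have "insert 1 (Suc ` ?b c) \<in> decode (c' # w)" by (simp only:)
    then have "insert 1 (Suc ` ?b c) = insert 1 (Suc ` ?b c')" using one by blast
    moreover have "1 \<notin> Suc ` ?b c" "1 \<notin> Suc ` ?b c'"
      using min_block_cases[of w "label c"] min_block_cases[of w "label c'"] shift_decode(2)[of w] by blast+
    ultimately have "Suc ` ?b c = Suc ` ?b c'" by (metis insert_ident)
    then have "?b c = ?b c'" by (simp add: inj_image_eq_iff)
    moreover have "label c \<le> card (decode w)" "label c' \<le> card (decode w)"
      using W W' w' card_decode[OF W(2)] by (auto simp: letters_def)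
    ultimately have "label c = label c'"
      using nth_by_inject[OF finite_decode inj_on_min_key_decode empty_notin_decode] by blast
    then have "c = c'" using W(3) W'(3) by (auto simp: letters_def)
    then show "W = W'" by (simp add: W W' w')
  qed
qed simp

text \<open>A code of \<open>down \<sigma>\<close> is prolonged by the letter that puts 1 back into
  its block.\<close>

lemma ex_decode: "partition_on {1..n} \<sigma> \<Longrightarrow> \<exists>w\<in>codes id n. decode w = \<sigma>"
proof (induction n arbitrary: \<sigma>)
  case 0
  then show ?case by (simp add: partition_on_empty)
next
  case (Suc n)
  note \<sigma> = Suc.prems
  let ?f = "\<lambda>b. (\<lambda>x. x - 1) ` (b - {1::nat})"
  have block: "b \<subseteq> {1..Suc n}" "b \<noteq> {}" if "b \<in> \<sigma>" for b using partition_on_block[OF \<sigma> that] by auto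
  have Suc_f: "Suc ` ?f b = b - {1}" if "b \<in> \<sigma>" for b
  proof -
    have "(\<lambda>x. Suc (x - 1)) ` (b - {1}) = (\<lambda>x. x) ` (b - {1})"
      using block(1)[OF that] by (intro image_cong) auto
    then show ?thesis by (simp only: image_image image_ident)
  qed
  have down: "down \<sigma> = ?f ` \<sigma> - {{}}" by (simp add: down_def)
  have "1 \<in> \<Union>\<sigma>" using partition_onD1[OF \<sigma>] by auto
  then obtain B where B: "B \<in> \<sigma>" "1 \<in> B" by blast
  have one: "b = B" if "b \<in> \<sigma>" "1 \<in> b" for b using disjointD[OF partition_onD2[OF \<sigma>]] that B by blast
  have shift_down: "shift (down \<sigma>) = (\<lambda>b. b - {1}) ` \<sigma> - {{}}"
  proof -
    have "shift (down \<sigma>) = shift (?f ` \<sigma>) - {{}}"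
      unfolding down image_set_diff[OF inj_image_Suc] by simp
    also have "shift (?f ` \<sigma>) = (\<lambda>b. b - {1}) ` \<sigma>"
      unfolding image_image[of "(`) Suc"] using Suc_f by (rule image_cong[OF refl])
    finally show ?thesis .
  qed
  have "partition_on {1..n} (down \<sigma>)"
  proof -
    \<comment> \<open>Removing 1 is restriction to \<open>{2..Suc n}\<close>; the shift down
      follows.\<close>
    have "partition_on ({2..Suc n} \<inter> {1..Suc n}) ((\<inter>) {2..Suc n} ` \<sigma> - {{}})"
      by (rule partition_on_restrict[OF \<sigma>])
    moreover have "(\<inter>) {2..Suc n} ` \<sigma> = (\<lambda>b. b - {1}) ` \<sigma>"
    proof (rule image_cong[OF refl])
      fix b assume "b \<in> \<sigma>"
      then have "b \<subseteq> {1..Suc n}" by (rule block)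
      moreover have "{2..Suc n} = {1..Suc n} - {1}" by auto
      ultimately show "{2..Suc n} \<inter> b = b - {1}" by blast
    qed
    ultimately have "partition_on (Suc ` {1..n}) (shift (down \<sigma>))"
      unfolding shift_down image_Suc_atLeastAtMost by (simp add: numeral_2_eq_2)
    then have "partition_on ((\<lambda>x. x - 1) ` Suc ` {1..n}) ((`) (\<lambda>x. x - 1) ` shift (down \<sigma>) - {{}})"
      by (rule partition_on_inj_image) (auto simp: inj_on_def)
    moreover have pred_Suc: "(\<lambda>x. x - 1) ` Suc ` S = S" for S by (simp add: image_image)
    then have "(`) (\<lambda>x. x - 1) ` shift (down \<sigma>) = down \<sigma>"
      by (simp only: image_image[of "(`) _" "(`) _"] image_ident)
    moreover have "down \<sigma> - {{}} = down \<sigma>" by (simp add: down)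
    ultimately show ?thesis by (simp only: pred_Suc)
  qed
  then obtain w where w: "w \<in> codes id n" "decode w = down \<sigma>" using Suc.IH by blast
  have fB: "?f B = {} \<or> ?f B \<in> decode w"
    using imageI[OF B(1), of ?f] unfolding w(2) down Diff_iff singleton_iff by argo
  \<comment> \<open>The index is 0 if 1 is a singleton, and otherwise the rank by minima of the rest
    of its block.\<close>
  obtain i where i: "i \<le> card (decode w)" "nth_by min_key (decode w) i = ?f B"
    using ex_nth_by[OF finite_decode inj_on_min_key_decode fB] by (elim exE conjE)
  define c where "c = (if i = 0 then None else Some i)"
  have c: "c \<in> letters id (heads w)" "label c = i"
    using i(1) card_decode[OF w(1)] by (auto simp: c_def letters_def)
  have "decode (c # w) = insert B (((\<lambda>b. b - {1}) ` \<sigma> - {{}}) - {B - {1}})"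
  proof -
    have "insert 1 (B - {1}) = B" using B(2) by blast
    then show ?thesis
      unfolding decode.simps adjoin_def c(2) i(2) Suc_f[OF B(1)] unfolding w(2) shift_down by simp
  qed
  also have "\<dots> = \<sigma>"
  proof (rule set_eqI)
    fix C
    have rest: "b - {1} = b" if "b \<in> \<sigma>" "b \<noteq> B" for b using one that by blast
    have disj: "b \<noteq> B - {1}" if "b \<in> \<sigma>" "b \<noteq> B" for b
      using disjointD[OF partition_onD2[OF \<sigma>] that(1) B(1) that(2)] block[OF that(1)] by blast
    show "C \<in> insert B (((\<lambda>b. b - {1}) ` \<sigma> - {{}}) - {B - {1}}) \<longleftrightarrow> C \<in> \<sigma>"
    proof
      assume "C \<in> insert B (((\<lambda>b. b - {1}) ` \<sigma> - {{}}) - {B - {1}})"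
      then consider "C = B" | b where "b \<in> \<sigma>" "C = b - {1}" "C \<noteq> B - {1}" by blast
      then show "C \<in> \<sigma>"
      proof cases
        case 2
        then have "b \<noteq> B" by blast
        then show ?thesis using rest 2 by metis
      qed (use B in simp)
    next
      assume C: "C \<in> \<sigma>"
      show "C \<in> insert B (((\<lambda>b. b - {1}) ` \<sigma> - {{}}) - {B - {1}})"
      proof (cases "C = B")
        case False
        then have "C \<in> (\<lambda>b. b - {1}) ` \<sigma>" by (intro image_eqI[OF _ C]) (rule rest[OF C False, symmetric])
        then show ?thesis using disj[OF C] False block(2)[OF C] by blast
      qed simp
    qed
  qed
  finally show ?case using w(1) c(1) Cons_in_codes by blast
qed

lemma bij_betw_decode: "bij_betw decode (codes id n) (set_partitions n)"
  unfolding bij_betw_def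
proof (intro conjI inj_on_decode equalityI subsetI)
  fix \<sigma> assume "\<sigma> \<in> decode ` codes id n"
  then obtain w where "w \<in> codes id n" "\<sigma> = decode w" by blast
  then show "\<sigma> \<in> set_partitions n"
    using partition_on_decode[of w] length_codes[of w id n] by (simp add: set_partitions_def)
next
  fix \<sigma> assume "\<sigma> \<in> set_partitions n"
  then have "\<exists>w\<in>codes id n. decode w = \<sigma>" by (intro ex_decode) (simp add: set_partitions_def)
  then show "\<sigma> \<in> decode ` codes id n" by blast
qed

section \<open>Transition probabilities for partitions\<close>

lemma enriched_P_decode:
  assumes W: "W \<in> codes id (h + 1)" and W': "W' \<in> codes id (h + 1)"
  shows "enriched_P h z (decode W) (decode W') = code_P id z (h + 1) W W'"
proof -
  from W obtain c v where v: "W = c # v" "v \<in> codes id h" "c \<in> letters id (heads v)"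
    using codes_SucE[of W id h] by (metis Suc_eq_plus1)
  define J where "J i = J_op h i (decode v)" for i
  let ?k = "card (decode v)"
  have k: "?k = heads v" by (rule card_decode[OF v(2)])
  have down: "down (decode W) = decode v" by (simp only: v(1) down_decode)
  have J: "J i = decode (ins id i v)" if "1 \<le> i" for i
    unfolding J_def by (rule decode_ins[OF v(2) that, symmetric])
  have ins_codes: "ins id i v \<in> codes id (h + 1)" if "1 \<le> i" for i
    using ins_in_codes[OF v(2) that] by simp
  have J_eq: "J i = decode u \<longleftrightarrow> ins id i v = u" if "1 \<le> i" "u \<in> codes id (h + 1)" for i u
    using J[OF that(1)] inj_onD[OF inj_on_decode _ ins_codes[OF that(1)] that(2)] by auto
  have gt: "J i = decode v \<union> {{h + 1}}" if "?k < i" for i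
    using that unfolding J_def J_op_def by simp
  have "inj_on J {1..?k}"
  proof (rule inj_onI)
    fix i j assume ij: "i \<in> {1..?k}" "j \<in> {1..?k}" "J i = J j"
    then have "ins id i v = ins id j v" using J[of j] J_eq[OF _ ins_codes, of i j] by simp
    then show "i = j" using ij(1,2) unfolding k by (intro inj_onD[OF inj_on_ins])
  qed
  moreover have "J i \<noteq> decode v \<union> {{h + 1}}" if "i \<in> {1..?k}" for i
  proof
    assume "J i = decode v \<union> {{h + 1}}"
    \<comment> \<open>The partition with a new singleton is the outcome of the index
      \<open>?k + 1\<close>, and its code has one head more than that of a hit.\<close>
    then have "J i = decode (ins id (?k + 1) v)" using gt[of "?k + 1"] J[of "?k + 1"] by simp
    then have "ins id i v = ins id (?k + 1) v" using J_eq[OF _ ins_codes] that by simp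
    then have "heads (ins id i v) = heads (ins id (?k + 1) v)" by (rule arg_cong)
    then show False using that unfolding heads_ins k by simp
  qed
  moreover have "?k \<le> h + 1" unfolding k using heads_codes_le[OF v(2)] by simp
  ultimately have "enriched_P h z (decode W) (decode W') = (\<Sum>i=1..h+1. z i * of_bool (J i = decode W'))"
    using indexed_kernel_eq_sum[of J ?k "decode v \<union> {{h + 1}}" "h + 1" "decode W'" z] gt
    unfolding enriched_P_def down Let_def J_def[symmetric] by simp
  also have "\<dots> = code_P id z (h + 1) W W'"
    unfolding code_P_def v(1) list.sel using W' by (intro sum.cong refl) (simp add: J_eq)
  finally show ?thesis .
qed

section \<open>Arches and the product formula for partitions\<close>

text \<open>Adjoining 1 shifts the old arches without changing the blocks they meet. If 1 joins
  \<open>b\<close>, the one new arch ends at the shifted minimum of \<open>b\<close> and meets the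
  blocks with minimum at most \<open>Min b\<close>. Their number is the rank of \<open>b\<close>,
  that is, the label.\<close>

lemma prod_arches_decode_Cons:
  assumes v: "v \<in> codes id n" and c: "c \<in> letters id (heads v)"
  shows "(\<Prod>(s, t)\<in>arches (Suc n) (decode (c # v)). z (C_arch (decode (c # v)) s t))
    = (case c of None \<Rightarrow> 1 | Some j \<Rightarrow> z j) * (\<Prod>(s, t)\<in>arches n (decode v). z (C_arch (decode v) s t))"
proof -
  define \<tau> where "\<tau> = decode v"
  define b where "b = nth_by min_key \<tau> (label c)"
  define \<sigma> where "\<sigma> = decode (c # v)"
  have n: "length v = n" using length_codes[OF v] .
  have part: "partition_on {1..n} \<tau>" using partition_on_decode[of v] by (simp add: \<tau>_def n)
  have fin: "finite \<tau>" by (simp add: \<tau>_def finite_decode)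
  have ne: "{} \<notin> \<tau>" by (simp add: \<tau>_def empty_notin_decode)
  have k: "card \<tau> = heads v" using card_decode[OF v] by (simp add: \<tau>_def)
  have b: "b = {} \<or> b \<in> \<tau>" unfolding b_def by (rule nth_by_cases[OF fin inj_on_keys(1)[OF part]])
  have b_empty: "b = {} \<longleftrightarrow> c = None"
    unfolding b_def using nth_by_eq_empty_iff[OF fin inj_on_keys(1)[OF part] ne, of "label c"] c k
    by (auto simp: letters_def)
  \<comment> \<open>\<open>E\<close> sends each old block to its successor in
    \<open>\<sigma>\<close>; a new singleton \<open>{1}\<close> is treated apart.\<close>
  define E where "E C = (if C = b then insert 1 (Suc ` C) else Suc ` C)" for C
  have "\<sigma> = (\<lambda>C. if C = Suc ` b then insert 1 C else C) ` shift \<tau> \<union> (if Suc ` b = {} then {{1}} else {})"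
    unfolding \<sigma>_def decode.simps \<tau>_def[symmetric] b_def[symmetric]
    using b ne by (intro adjoin_eq_image) auto
  also have "\<dots> = E ` \<tau> \<union> (if b = {} then {{1}} else {})"
    unfolding image_image E_def by (simp add: inj_image_eq_iff)
  finally have \<sigma>: "\<sigma> = E ` \<tau> \<union> (if b = {} then {{1}} else {})" .
  have ex: "(\<exists>C\<in>\<sigma>. P C) \<longleftrightarrow> (\<exists>C\<in>\<tau>. P (E C)) \<or> (b = {} \<and> P {1})" for P
    unfolding \<sigma> by auto
  note block = partition_on_block[OF part]
  have zero: "0 \<notin> C" if "C \<in> \<tau>" for C using subsetD[OF block(3)[OF that], of 0] by auto
  have one: "1 \<in> E C \<longleftrightarrow> C = b" if "C \<in> \<tau>" for C using zero[OF that] by (auto simp: E_def)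
  have Suc: "Suc x \<in> E C \<longleftrightarrow> x \<in> C" if "1 \<le> x" for x C using that by (auto simp: E_def)
  have injE: "inj_on E \<tau>"
  proof (rule inj_onI)
    fix C D assume CD: "C \<in> \<tau>" "D \<in> \<tau>" "E C = E D"
    have "x \<in> C \<longleftrightarrow> x \<in> D" for x
      using Suc[of x C] Suc[of x D] zero[OF CD(1)] zero[OF CD(2)] CD(3) by (cases x) simp_all
    then show "C = D" by blast
  qed
  have greater: "E C \<inter> {Suc s<..<Suc t} = {} \<longleftrightarrow> C \<inter> {s<..<t} = {}" for C s t
  proof -
    have "E C \<inter> {Suc s<..<Suc t} = Suc ` (C \<inter> {s<..<t})"
    proof (rule set_eqI)
      fix x show "x \<in> E C \<inter> {Suc s<..<Suc t} \<longleftrightarrow> x \<in> Suc ` (C \<inter> {s<..<t})"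
        using Suc[of "x - 1" C] by (cases x) auto
    qed
    then show ?thesis by simp
  qed
  have meets: "E C \<inter> {Suc s..Suc t} = {} \<longleftrightarrow> C \<inter> {s..t} = {}" if "1 \<le> s" for C s t
  proof -
    have "E C \<inter> {Suc s..Suc t} = Suc ` (C \<inter> {s..t})"
    proof (rule set_eqI)
      fix x show "x \<in> E C \<inter> {Suc s..Suc t} \<longleftrightarrow> x \<in> Suc ` (C \<inter> {s..t})"
        using Suc[of "x - 1" C] that by (cases x) auto
    qed
    then show ?thesis by simp
  qed
  have le_n: "x \<le> n" if "x \<in> C" "C \<in> \<tau>" for x C using block(3)[OF that(2)] that(1) by auto

  have C_shift: "C_arch \<sigma> (Suc s) (Suc t) = C_arch \<tau> s t" if "1 \<le> s" for s t
  proof -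
    have "{B \<in> \<sigma>. B \<inter> {Suc s..Suc t} \<noteq> {}} = E ` {C \<in> \<tau>. C \<inter> {s..t} \<noteq> {}}"
      unfolding \<sigma> using meets[OF that] that by auto
    then show ?thesis unfolding C_arch_def by (simp add: card_image inj_on_subset[OF injE])
  qed
  have C_first: "C_arch \<sigma> 1 (Suc (Min b)) = label c" if "b \<noteq> {}"
  proof -
    have bt: "b \<in> \<tau>" using b that by blast
    \<comment> \<open>The block \<open>b\<close> contains 1 after the step; any other block enters
      the interval through its minimum.\<close>
    have meet: "E C \<inter> {1..Suc (Min b)} \<noteq> {} \<longleftrightarrow> Min C \<le> Min b" if C: "C \<in> \<tau>" for C
    proof
      assume "Min C \<le> Min b"
      moreover have "Min C \<in> C" using block[OF C] by simp
      moreover have "1 \<le> Min C" using zero[OF C] \<open>Min C \<in> C\<close> by (metis One_nat_def Suc_leI gr0I)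
      ultimately have "Suc (Min C) \<in> E C \<inter> {1..Suc (Min b)}" using Suc by simp
      then show "E C \<inter> {1..Suc (Min b)} \<noteq> {}" by blast
    next
      assume "E C \<inter> {1..Suc (Min b)} \<noteq> {}"
      then obtain x where x: "x \<in> E C" "1 \<le> x" "x \<le> Suc (Min b)" by auto
      show "Min C \<le> Min b"
      proof (cases "x = 1")
        case True
        then show ?thesis using x one[OF C] by simp
      next
        case False
        then have "x - 1 \<in> C" using x Suc[of "x - 1" C] by simp
        then have "Min C \<le> x - 1" using block[OF C] by simp
        then show ?thesis using x by simp
      qed
    qed
    have "{B \<in> \<sigma>. B \<inter> {1..Suc (Min b)} \<noteq> {}} = E ` {C \<in> \<tau>. Min C \<le> Min b}"
      unfolding \<sigma> using meet that by auto
    then have "C_arch \<sigma> 1 (Suc (Min b)) = card {C \<in> \<tau>. min_key C \<le> min_key b}"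
      unfolding C_arch_def min_key_def by (simp add: card_image inj_on_subset[OF injE])
    also have "\<dots> = label c"
      unfolding b_def
      using that nth_by_eq_empty_iff[OF fin inj_on_keys(1)[OF part] ne, of "label c"]
      by (intro nth_by_rank(2)[OF fin inj_on_keys(1)[OF part]]) (simp add: b_def)
    finally show ?thesis .
  qed

  let ?S = "\<lambda>(s, t). (Suc s, Suc t)"
  have arches: "arches (Suc n) \<sigma> = ?S ` arches n \<tau> \<union> (if b = {} then {} else {(1, Suc (Min b))})"
    (is "?L = ?R")
  proof (rule set_eqI, clarify)
    fix s t :: nat
    have S_iff: "(s, t) \<in> ?S ` arches n \<tau> \<longleftrightarrow> (\<exists>s' t'. s = Suc s' \<and> t = Suc t' \<and> (s', t') \<in> arches n \<tau>)"
      by force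
    \<comment> \<open>Only the new arch can start at 1; those starting at 2 or later are shifted old
      ones.\<close>
    consider "s = 0" | "t = 0" | t' where "s = 1" "t = Suc t'"
      | s' t' where "s = Suc s'" "t = Suc t'" "1 \<le> s'"
      by (metis One_nat_def Suc_leI gr0_conv_Suc not_gr_zero)
    then show "(s, t) \<in> ?L \<longleftrightarrow> (s, t) \<in> ?R"
    proof cases
      case (3 t')
      have "(s, t) \<in> ?L \<longleftrightarrow> 1 \<le> t' \<and> t' \<le> n \<and> (\<exists>C\<in>\<sigma>. 1 \<in> C \<and> Suc t' \<in> C \<and> C \<inter> {Suc 0<..<Suc t'} = {})"
        by (auto simp: arches_def 3)
      also have "\<dots> \<longleftrightarrow> 1 \<le> t' \<and> t' \<le> n \<and> b \<in> \<tau> \<and> t' \<in> b \<and> b \<inter> {0<..<t'} = {}"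
        unfolding ex using one Suc[of t'] greater[of _ 0 t'] by auto
      also have "\<dots> \<longleftrightarrow> b \<noteq> {} \<and> t' = Min b"
      proof
        assume *: "1 \<le> t' \<and> t' \<le> n \<and> b \<in> \<tau> \<and> t' \<in> b \<and> b \<inter> {0<..<t'} = {}"
        have "t' \<le> x" if x: "x \<in> b" for x
        proof (rule ccontr)
          assume "\<not> t' \<le> x"
          moreover have "x \<noteq> 0" using zero[of b] * x by metis
          ultimately have "x \<in> b \<inter> {0<..<t'}" using x by simp
          then show False using * by blast
        qed
        then have "Min b = t'" using * block(1)[of b] by (intro Min_eqI) auto
        then show "b \<noteq> {} \<and> t' = Min b" using * by blast
      next
        assume *: "b \<noteq> {} \<and> t' = Min b"
        then have bt: "b \<in> \<tau>" using b by blast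
        have t': "t' \<in> b" using * block(1)[OF bt] by simp
        have "t' \<noteq> 0" using zero[OF bt] t' by metis
        moreover have "\<not> x < t'" if "x \<in> b" for x using * Min_le[OF block(1)[OF bt] that] by simp
        then have "b \<inter> {0<..<t'} = {}" by auto
        ultimately show "1 \<le> t' \<and> t' \<le> n \<and> b \<in> \<tau> \<and> t' \<in> b \<and> b \<inter> {0<..<t'} = {}"
          using t' bt le_n[OF t' bt] by simp
      qed
      also have "\<dots> \<longleftrightarrow> (s, t) \<in> ?R"
      proof -
        have "(s, t) \<notin> ?S ` arches n \<tau>" unfolding S_iff by (auto simp: 3 arches_def)
        then show ?thesis using 3 by auto
      qed
      finally show ?thesis .
    next
      case (4 s' t')
      have "(s, t) \<in> ?L \<longleftrightarrow> s' < t' \<and> t' \<le> n \<and> (\<exists>C\<in>\<sigma>. Suc s' \<in> C \<and> Suc t' \<in> C \<and> C \<inter> {Suc s'<..<Suc t'} = {})"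
        using 4 by (auto simp: arches_def)
      also have "\<dots> \<longleftrightarrow> (s', t') \<in> arches n \<tau>"
        unfolding ex using 4(3) Suc[of s'] Suc[of t'] greater[of _ s' t'] by (auto simp: arches_def)
      also have "\<dots> \<longleftrightarrow> (s, t) \<in> ?R" using 4 S_iff by auto
      finally show ?thesis .
    qed (auto simp: arches_def S_iff)
  qed
  have fin_arches: "finite (arches m \<rho>)" for m \<rho>
    by (rule finite_subset[of _ "{1..m} \<times> {1..m}"]) (auto simp: arches_def)
  have "(\<Prod>p\<in>?S ` arches n \<tau>. case p of (s, t) \<Rightarrow> z (C_arch \<sigma> s t)) = (\<Prod>(s, t)\<in>arches n \<tau>. z (C_arch \<tau> s t))"
  proof (subst prod.reindex)
    show "inj_on ?S (arches n \<tau>)" by (auto simp: inj_on_def)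
    show "prod ((\<lambda>p. case p of (s, t) \<Rightarrow> z (C_arch \<sigma> s t)) \<circ> ?S) (arches n \<tau>)
        = (\<Prod>(s, t)\<in>arches n \<tau>. z (C_arch \<tau> s t))"
      by (rule prod.cong[OF refl]) (auto simp: arches_def C_shift)
  qed
  moreover have "(1, Suc (Min b)) \<notin> ?S ` arches n \<tau>" by (auto simp: arches_def)
  ultimately have "(\<Prod>(s, t)\<in>arches (Suc n) \<sigma>. z (C_arch \<sigma> s t))
      = (if b = {} then 1 else z (label c)) * (\<Prod>(s, t)\<in>arches n \<tau>. z (C_arch \<tau> s t))"
    unfolding arches using C_first fin_arches by simp
  then show ?thesis using b_empty by (simp add: \<sigma>_def \<tau>_def split: option.splits)
qed

text \<open>The heads from right to left see 0, 1, ... heads behind them. The labelling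
  \<open>id\<close> has singleton fibres, so \<open>Some j\<close> has weight \<open>z j\<close>,
  the factor of its arch.\<close>

lemma enriched_Pi_decode:
  assumes sum1: "(\<Sum>i=1..h+1. z i) = 1" and W: "W \<in> codes id (h + 1)"
  shows "enriched_Pi h z (decode W) = code_wt id z W"
proof -
  have wt: "(\<Prod>(s, t)\<in>arches n (decode w). z (C_arch (decode w) s t)) * (\<Prod>i<heads w. 1 - (\<Sum>m=1..i. z m))
      = code_wt id z w" if "w \<in> codes id n" for n w
    using that
  proof (induction n arbitrary: w)
    case 0
    then have "arches 0 (decode w) = {}" by (auto simp: arches_def)
    then show ?case using 0 by simp
  next
    case (Suc n)
    from Suc.prems obtain c v where w: "w = c # v" "v \<in> codes id n" "c \<in> letters id (heads v)"
      by (rule codes_SucE)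
    let ?A = "\<Prod>(s, t)\<in>arches n (decode v). z (C_arch (decode v) s t)"
    show ?case
    proof (cases c)
      case None
      have P: "(\<Prod>(s, t)\<in>arches (Suc n) (decode w). z (C_arch (decode w) s t)) = ?A"
        using prod_arches_decode_Cons[OF w(2,3), of z] unfolding w(1) None by simp
      have C: "code_wt id z w = (1 - (\<Sum>m=1..heads v. z m)) * code_wt id z v"
        unfolding w(1) None by simp
      have H: "heads w = Suc (heads v)" unfolding w(1) None by simp
      show ?thesis unfolding P C H Suc.IH[OF w(2), symmetric] by (simp add: mult_ac)
    next
      case (Some j)
      then have "j \<in> {1..heads v}" using w(3) by (auto simp: letters_def)
      then have "{m. m \<in> {1..heads v} \<and> id m = j} = {j}" by auto
      then have C: "code_wt id z w = z j * code_wt id z v"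
        unfolding w(1) Some code_wt.simps letter_wt.simps by simp
      have P: "(\<Prod>(s, t)\<in>arches (Suc n) (decode w). z (C_arch (decode w) s t)) = z j * ?A"
        using prod_arches_decode_Cons[OF w(2,3), of z] unfolding w(1) Some by simp
      have H: "heads w = heads v" unfolding w(1) Some by simp
      show ?thesis unfolding P C H Suc.IH[OF w(2), symmetric] by (simp add: mult_ac)
    qed
  qed
  have k: "card (decode W) = heads W" by (rule card_decode[OF W])
  \<comment> \<open>The ground set is nonempty, so there is a head. The factor for
    \<open>i = 0\<close> equals 1 and can be split off, which leaves the product from 1.\<close>
  have "decode W \<noteq> {}"
    using partition_onD1[OF partition_on_decode[of W]] length_codes[OF W] by auto
  then have "heads W \<noteq> 0" using k finite_decode[of W] by auto
  then have "{..<heads W} = insert 0 {1..heads W - 1}" by auto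
  then have "(\<Prod>i<heads W. 1 - (\<Sum>m=1..i. z m)) = (\<Prod>i=1..heads W - 1. 1 - (\<Sum>m=1..i. z m))" by simp
  also have "\<dots> = (\<Prod>i=1..heads W - 1. \<Sum>m=i+1..h+1. z m)"
  proof (rule prod.cong[OF refl])
    fix i assume "i \<in> {1..heads W - 1}"
    then have "i \<le> h + 1" using heads_codes_le[OF W] unfolding atLeastAtMost_iff by linarith
    then show "1 - (\<Sum>m=1..i. z m) = (\<Sum>m=i+1..h+1. z m)"
      using sum1 sum_up_to_split[of i "h + 1" z] by simp
  qed
  finally show ?thesis unfolding enriched_Pi_def k wt[OF W, symmetric] by simp
qed

theorem unique_stationary_enriched:
  assumes nonneg: "\<And>i. i \<in> {1..h+1} \<Longrightarrow> 0 \<le> z i" and sum1: "(\<Sum>i=1..h+1. z i) = 1"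
  shows "unique_stationary (set_partitions (h + 1)) (enriched_P h z) (enriched_Pi h z)"
proof (rule unique_stationary_transport)
  \<comment> \<open>The transport goes from partitions to codes, hence the inverse of
    \<open>decode\<close>.\<close>
  let ?code = "inv_into (codes id (h + 1)) decode"
  show bij: "bij_betw ?code (set_partitions (h + 1)) (codes id (h + 1))"
    by (rule bij_betw_inv_into[OF bij_betw_decode])
  have code: "?code \<sigma> \<in> codes id (h + 1)" if "\<sigma> \<in> set_partitions (h + 1)" for \<sigma>
    using bij that by (rule bij_betwE[rule_format])
  have decode: "decode (?code \<sigma>) = \<sigma>" if "\<sigma> \<in> set_partitions (h + 1)" for \<sigma>
    using bij_betw_decode that by (rule bij_betw_inv_into_right)
  show "unique_stationary (codes id (h + 1)) (code_P id z (h + 1)) (code_wt id z)"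
    using assms by (rule unique_stationary_codes)
  show "enriched_P h z \<sigma> \<tau> = code_P id z (h + 1) (?code \<sigma>) (?code \<tau>)"
    if "\<sigma> \<in> set_partitions (h + 1)" "\<tau> \<in> set_partitions (h + 1)" for \<sigma> \<tau>
    using enriched_P_decode[OF code[OF that(1)] code[OF that(2)], of z] decode that by simp
  show "enriched_Pi h z \<sigma> = code_wt id z (?code \<sigma>)" if "\<sigma> \<in> set_partitions (h + 1)" for \<sigma>
    using enriched_Pi_decode[OF sum1 code[OF that]] decode[OF that] by simp
qed

theorem theorem4p12:
  fixes h H :: nat and z :: "nat \<Rightarrow> real" and a :: real
  assumes "H = h + 1"
    and "\<And>i. 1 \<le> i \<Longrightarrow> i \<le> h \<Longrightarrow> 0 \<le> z i"
    and "z (h + 1) = a" and "0 \<le> a"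
    and "(\<Sum>i=1..h. z i) + a = 1"
  shows "(stationary_distribution (St h) (annihilation_P h z) (annihilation_Pi h z) \<and>
          (\<forall>p. stationary_distribution (St h) (annihilation_P h z) p \<longrightarrow>
               (\<forall>B\<in>St h. p B = annihilation_Pi h z B))) \<and>
         (stationary_distribution (set_partitions H) (enriched_P h z) (enriched_Pi h z) \<and>
          (\<forall>p. stationary_distribution (set_partitions H) (enriched_P h z) p \<longrightarrow>
               (\<forall>\<sigma>\<in>set_partitions H. p \<sigma> = enriched_Pi h z \<sigma>)))"
proof -
  have nonneg: "0 \<le> z i" if "i \<in> {1..h+1}" for i
    using that assms(2)[of i] assms(3,4) by (cases "i = h + 1") auto
  have sum1: "(\<Sum>i=1..h+1. z i) = 1" using assms(3,5) by simp
  show ?thesis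
    using unique_stationary_annihilation[OF nonneg sum1] unique_stationary_enriched[OF nonneg sum1]
    unfolding unique_stationary_def \<open>H = h + 1\<close> by blast
qed

end
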